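(* Let $R$ be a ring with unity, let $\mathcal{X}$ be a semibrick of left $R$-modules and let $f:M\to N$ be a nonzero homomorphism between two $\mathcal{X}$-semisimple modules $M$ and $N$. Then $\ker f$ and $\mathrm{coker}\,f$ are $\mathcal{X}$-semisimple.
   Context: A brick is a finitely presented left $R$-module whose endomorphism ring is a division ring. A semibrick is a class $\mathcal{X}$ of pairwise non-isomorphic bricks with $\mathrm{Hom}(X,X')=0$ for distinct $X,X'\in\mathcal{X}$. A module is $\mathcal{X}$-semisimple if it is isomorphic to a (possibly empty or infinite) direct sum of objects from $\mathcal{X}$ (repetitions allowed). *)

theory Defs
  imports "HOL-Algebra.Module" "HOL-Algebra.QuotRing"
begin

(* HOL-Algebra's locale "module" requires a commutative ring of scalars, so left modules over an
   arbitrary ring are introduced here, on the same record type. The fields mult and one, which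
   that record inherits from rings, play no role in any definition below. *)
locale left_module = R?: ring R + M?: abelian_group M
  for R :: "('r, 'e) ring_scheme" (structure) and M :: "('r, 'a, 'm) module_scheme" (structure) +
  assumes smult_closed [simp, intro]:
      "\<lbrakk>a \<in> carrier R; x \<in> carrier M\<rbrakk> \<Longrightarrow> a \<odot>\<^bsub>M\<^esub> x \<in> carrier M"
    and smult_l_distr:
      "\<lbrakk>a \<in> carrier R; b \<in> carrier R; x \<in> carrier M\<rbrakk> \<Longrightarrow>
       (a \<oplus> b) \<odot>\<^bsub>M\<^esub> x = a \<odot>\<^bsub>M\<^esub> x \<oplus>\<^bsub>M\<^esub> b \<odot>\<^bsub>M\<^esub> x"
    and smult_r_distr:
      "\<lbrakk>a \<in> carrier R; x \<in> carrier M; y \<in> carrier M\<rbrakk> \<Longrightarrow>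
       a \<odot>\<^bsub>M\<^esub> (x \<oplus>\<^bsub>M\<^esub> y) = a \<odot>\<^bsub>M\<^esub> x \<oplus>\<^bsub>M\<^esub> a \<odot>\<^bsub>M\<^esub> y"
    and smult_assoc1:
      "\<lbrakk>a \<in> carrier R; b \<in> carrier R; x \<in> carrier M\<rbrakk> \<Longrightarrow>
       (a \<otimes> b) \<odot>\<^bsub>M\<^esub> x = a \<odot>\<^bsub>M\<^esub> (b \<odot>\<^bsub>M\<^esub> x)"
    and smult_one [simp]:
      "x \<in> carrier M \<Longrightarrow> \<one> \<odot>\<^bsub>M\<^esub> x = x"

definition lmod_hom ::
    "('r, 'e) ring_scheme \<Rightarrow> ('r, 'a) module \<Rightarrow> ('r, 'b) module \<Rightarrow> ('a \<Rightarrow> 'b) set" where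
  "lmod_hom R M N =
     {h \<in> carrier M \<rightarrow> carrier N.
        (\<forall>x\<in>carrier M. \<forall>y\<in>carrier M. h (x \<oplus>\<^bsub>M\<^esub> y) = h x \<oplus>\<^bsub>N\<^esub> h y) \<and>
        (\<forall>r\<in>carrier R. \<forall>x\<in>carrier M. h (r \<odot>\<^bsub>M\<^esub> x) = r \<odot>\<^bsub>N\<^esub> h x)}"

(* Members of lmod_hom are unconstrained outside carrier M, so being the zero map is tested on
   the carrier only. *)
definition zero_map :: "('r, 'a) module \<Rightarrow> ('r, 'b) module \<Rightarrow> ('a \<Rightarrow> 'b) \<Rightarrow> bool" where
  "zero_map M N h \<longleftrightarrow> (\<forall>x\<in>carrier M. h x = \<zero>\<^bsub>N\<^esub>)"

definition lmod_iso ::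
    "('r, 'e) ring_scheme \<Rightarrow> ('r, 'a) module \<Rightarrow> ('r, 'b) module \<Rightarrow> bool" where
  "lmod_iso R M N \<longleftrightarrow> (\<exists>h\<in>lmod_hom R M N. bij_betw h (carrier M) (carrier N))"

definition lmod_sum :: "'i set \<Rightarrow> ('i \<Rightarrow> ('r, 'a) module) \<Rightarrow> ('r, 'i \<Rightarrow> 'a) module" where
  "lmod_sum I F =
     \<lparr>carrier = {x \<in> \<Pi>\<^sub>E i\<in>I. carrier (F i). finite {i \<in> I. x i \<noteq> \<zero>\<^bsub>F i\<^esub>}},
      mult = undefined, one = undefined,
      zero = (\<lambda>i\<in>I. \<zero>\<^bsub>F i\<^esub>),
      add = (\<lambda>x y. \<lambda>i\<in>I. x i \<oplus>\<^bsub>F i\<^esub> y i),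
      smult = (\<lambda>r x. \<lambda>i\<in>I. r \<odot>\<^bsub>F i\<^esub> x i)\<rparr>"

definition lmod_kernel ::
    "('r, 'a) module \<Rightarrow> ('r, 'b) module \<Rightarrow> ('a \<Rightarrow> 'b) \<Rightarrow> ('r, 'a) module" where
  "lmod_kernel M N f = M\<lparr>carrier := a_kernel M N f\<rparr>"

(* As for multiplication in FactRing, scalar multiplication of cosets is the union over all
   representatives; these all give the same coset when H is a submodule. *)
definition lmod_quotient :: "('r, 'b) module \<Rightarrow> 'b set \<Rightarrow> ('r, 'b set) module" where
  "lmod_quotient N H =
     \<lparr>carrier = a_rcosets\<^bsub>N\<^esub> H,
      mult = undefined, one = undefined,
      zero = H,
      add = set_add N,
      smult = (\<lambda>r C. \<Union>x\<in>C. H +>\<^bsub>N\<^esub> (r \<odot>\<^bsub>N\<^esub> x))\<rparr>"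

definition lmod_cokernel ::
    "('r, 'a) module \<Rightarrow> ('r, 'b) module \<Rightarrow> ('a \<Rightarrow> 'b) \<Rightarrow> ('r, 'b set) module" where
  "lmod_cokernel M N f = lmod_quotient N (f ` carrier M)"

definition regular_module :: "('r, 'e) ring_scheme \<Rightarrow> ('r, 'r) module" where
  "regular_module R =
     \<lparr>carrier = carrier R, mult = mult R, one = one R, zero = zero R, add = add R,
      smult = mult R\<rparr>"

abbreviation free_module :: "('r, 'e) ring_scheme \<Rightarrow> nat \<Rightarrow> ('r, nat \<Rightarrow> 'r) module" where
  "free_module R n \<equiv> lmod_sum {..<n} (\<lambda>_. regular_module R)"

(* An exact sequence R^m \<rightarrow> R^n \<rightarrow> M \<rightarrow> 0. *)
definition finitely_presented :: "('r, 'e) ring_scheme \<Rightarrow> ('r, 'a) module \<Rightarrow> bool" where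
  "finitely_presented R M \<longleftrightarrow>
     (\<exists>m n. \<exists>p\<in>lmod_hom R (free_module R m) (free_module R n).
            \<exists>q\<in>lmod_hom R (free_module R n) M.
        p ` carrier (free_module R m) = a_kernel (free_module R n) M q \<and>
        q ` carrier (free_module R n) = carrier M)"

(* Restricting to extensional functions makes equality of endomorphisms agree with equality on
   the carrier. *)
definition lmod_End :: "('r, 'e) ring_scheme \<Rightarrow> ('r, 'a) module \<Rightarrow> ('a \<Rightarrow> 'a) ring" where
  "lmod_End R M =
     \<lparr>carrier = lmod_hom R M M \<inter> extensional (carrier M),
      mult = compose (carrier M),
      one = (\<lambda>x\<in>carrier M. x),
      zero = (\<lambda>x\<in>carrier M. \<zero>\<^bsub>M\<^esub>),
      add = (\<lambda>g h. \<lambda>x\<in>carrier M. g x \<oplus>\<^bsub>M\<^esub> h x)\<rparr>"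

(* Division rings; the equation also forces \<one> \<noteq> \<zero>. *)
locale skew_field = ring +
  assumes skew_field_Units: "Units R = carrier R - {\<zero>}"

definition brick :: "('r, 'e) ring_scheme \<Rightarrow> ('r, 'a) module \<Rightarrow> bool" where
  "brick R X \<longleftrightarrow> left_module R X \<and> finitely_presented R X \<and> skew_field (lmod_End R X)"

(* Members are compared as records. Two records presenting the same module are isomorphic, so at
   most one of them can belong to a semibrick. *)
definition semibrick :: "('r, 'e) ring_scheme \<Rightarrow> ('r, 'a) module set \<Rightarrow> bool" where
  "semibrick R \<X> \<longleftrightarrow>
     (\<forall>X\<in>\<X>. brick R X) \<and>
     (\<forall>X\<in>\<X>. \<forall>Y\<in>\<X>. X \<noteq> Y \<longrightarrow> \<not> lmod_iso R X Y \<and> (\<forall>h\<in>lmod_hom R X Y. zero_map X Y h))"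

(* HOL cannot quantify existentially over the type of the index set I, so I is taken inside the
   carrier type of M. For a semibrick this loses nothing: bricks are nonzero, hence the index set
   of any decomposition of M embeds into M (lemma semisimpleI below). *)
definition semisimple ::
    "('r, 'e) ring_scheme \<Rightarrow> ('r, 'a) module set \<Rightarrow> ('r, 'm) module \<Rightarrow> bool" where
  "semisimple R \<X> M \<longleftrightarrow>
     left_module R M \<and>
     (\<exists>(I :: 'm set) F. (\<forall>i\<in>I. F i \<in> \<X>) \<and> lmod_iso R M (lmod_sum I F))"

lemma brick_nonzero:
  assumes "brick R X"
  shows "\<exists>x\<in>carrier X. x \<noteq> \<zero>\<^bsub>X\<^esub>"
proof (rule ccontr)
  assume "\<not> ?thesis"
  then have "\<one>\<^bsub>lmod_End R X\<^esub> = \<zero>\<^bsub>lmod_End R X\<^esub>"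
    by (auto simp: lmod_End_def restrict_def)
  moreover interpret skew_field "lmod_End R X"
    using assms by (simp add: brick_def)
  have "\<one>\<^bsub>lmod_End R X\<^esub> \<in> Units (lmod_End R X)"
    by simp
  ultimately show False
    using skew_field_Units by simp
qed

lemma lmod_iso_trans:
  assumes "lmod_iso R L M" "lmod_iso R M N"
  shows "lmod_iso R L N"
proof -
  obtain g h where g: "g \<in> lmod_hom R L M" "bij_betw g (carrier L) (carrier M)"
    and h: "h \<in> lmod_hom R M N" "bij_betw h (carrier M) (carrier N)"
    using assms by (auto simp: lmod_iso_def)
  have "h \<circ> g \<in> lmod_hom R L N"
    using g(1) h(1) by (auto simp: lmod_hom_def Pi_iff)
  then show ?thesis
    using bij_betw_trans[OF g(2) h(2)] by (auto simp: lmod_iso_def)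
qed

lemma lmod_sum_reindex:
  fixes F :: "'i \<Rightarrow> ('r, 'a) module" and g :: "'j \<Rightarrow> 'i"
  assumes g: "bij_betw g J I" and mod: "\<And>i. i \<in> I \<Longrightarrow> left_module R (F i)"
  shows "lmod_iso R (lmod_sum I F) (lmod_sum J (F \<circ> g))"
proof -
  let ?A = "carrier (lmod_sum I F)" and ?B = "carrier (lmod_sum J (F \<circ> g))"
  define k where "k = inv_into J g"
  define T where "T = (\<lambda>x :: 'i \<Rightarrow> 'a. \<lambda>j\<in>J. x (g j))"
  define S where "S = (\<lambda>y :: 'j \<Rightarrow> 'a. \<lambda>i\<in>I. y (k i))"
  have gI: "g j \<in> I" "k (g j) = j" if "j \<in> J" for j
    using g that by (auto simp: k_def bij_betw_def)
  have kJ: "k i \<in> J" "g (k i) = i" if "i \<in> I" for i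
    using g that by (auto simp: k_def bij_betw_def inv_into_into f_inv_into_f)
  have T: "T x \<in> ?B" if "x \<in> ?A" for x
  proof -
    have "{j \<in> J. T x j \<noteq> \<zero>\<^bsub>F (g j)\<^esub>} \<subseteq> k ` {i \<in> I. x i \<noteq> \<zero>\<^bsub>F i\<^esub>}"
      using gI by (force simp: T_def image_iff)
    then have "finite {j \<in> J. T x j \<noteq> \<zero>\<^bsub>F (g j)\<^esub>}"
      by (rule finite_subset) (use that in \<open>auto simp: lmod_sum_def\<close>)
    then show ?thesis
      using that gI by (auto simp: lmod_sum_def T_def PiE_iff)
  qed
  have S: "S y \<in> ?A" if "y \<in> ?B" for y
  proof -
    have "{i \<in> I. S y i \<noteq> \<zero>\<^bsub>F i\<^esub>} \<subseteq> g ` {j \<in> J. y j \<noteq> \<zero>\<^bsub>F (g j)\<^esub>}"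
      using kJ by (force simp: S_def image_iff)
    then have "finite {i \<in> I. S y i \<noteq> \<zero>\<^bsub>F i\<^esub>}"
      by (rule finite_subset) (use that in \<open>auto simp: lmod_sum_def\<close>)
    moreover have "y (k i) \<in> carrier (F i)" if "i \<in> I" for i
      using \<open>y \<in> ?B\<close> kJ[OF that] by (force simp: lmod_sum_def PiE_iff)
    ultimately show ?thesis
      by (auto simp: lmod_sum_def S_def PiE_iff)
  qed
  have "S (T x) = x" if "x \<in> ?A" for x
    using that kJ by (auto simp: lmod_sum_def S_def T_def PiE_iff intro!: extensionalityI[of _ I])
  moreover have "T (S y) = y" if "y \<in> ?B" for y
    using that gI by (auto simp: lmod_sum_def S_def T_def PiE_iff intro!: extensionalityI[of _ J])
  ultimately have "bij_betw T ?A ?B"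
    by (intro bij_betw_byWitness[where f' = S]) (use T S in auto)
  moreover have "T \<in> lmod_hom R (lmod_sum I F) (lmod_sum J (F \<circ> g))"
    using T gI unfolding lmod_hom_def by (auto simp: lmod_sum_def T_def fun_eq_iff)
  ultimately show ?thesis
    by (auto simp: lmod_iso_def)
qed

lemma semisimpleI:
  fixes I :: "'i set" and M :: "('r, 'm) module"
  assumes X: "semibrick R \<X>" and M: "left_module R M"
    and F: "\<And>i. i \<in> I \<Longrightarrow> F i \<in> \<X>" and iso: "lmod_iso R M (lmod_sum I F)"
  shows "semisimple R \<X> M"
proof -
  have bricks: "brick R (F i)" if "i \<in> I" for i
    using X F that by (auto simp: semibrick_def)
  then have mods: "left_module R (F i)" if "i \<in> I" for i
    using that by (simp add: brick_def)
  have "\<forall>i\<in>I. \<exists>e. e \<in> carrier (F i) \<and> e \<noteq> \<zero>\<^bsub>F i\<^esub>"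
    using bricks brick_nonzero by blast
  then obtain e where e: "\<And>i. i \<in> I \<Longrightarrow> e i \<in> carrier (F i)" "\<And>i. i \<in> I \<Longrightarrow> e i \<noteq> \<zero>\<^bsub>F i\<^esub>"
    by metis
  obtain h where h: "bij_betw h (carrier M) (carrier (lmod_sum I F))"
    using iso by (auto simp: lmod_iso_def)
  define v where "v = (\<lambda>i. \<lambda>j\<in>I. if j = i then e i else \<zero>\<^bsub>F j\<^esub>)"
  have v: "v i \<in> carrier (lmod_sum I F)" if "i \<in> I" for i
  proof -
    have "\<zero>\<^bsub>F j\<^esub> \<in> carrier (F j)" if "j \<in> I" for j
      using mods[OF that] by (simp add: left_module_def abelian_group_def abelian_monoid.zero_closed)
    moreover have "finite {j \<in> I. v i j \<noteq> \<zero>\<^bsub>F j\<^esub>}"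
      by (rule finite_subset[of _ "{i}"]) (auto simp: v_def)
    ultimately show ?thesis
      using e that by (auto simp: lmod_sum_def v_def)
  qed
  have "inj_on v I"
  proof (rule inj_onI)
    fix i j assume "i \<in> I" "j \<in> I" "v i = v j"
    then have "v i i = v j i" by simp
    then show "i = j"
      using \<open>i \<in> I\<close> e by (auto simp: v_def split: if_splits)
  qed
  moreover have "inj_on (inv_into (carrier M) h) (v ` I)"
    using h v by (intro inj_on_subset[OF inj_on_inv_into[OF order_refl]]) (auto simp: bij_betw_def)
  ultimately have inj: "inj_on (inv_into (carrier M) h \<circ> v) I"
    by (rule comp_inj_on)
  define u where "u = inv_into (carrier M) h \<circ> v"
  have bij: "bij_betw (inv_into I u) (u ` I) I"
    using inj by (intro bij_betw_inv_into) (simp add: bij_betw_def u_def)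
  have "lmod_iso R M (lmod_sum (u ` I) (F \<circ> inv_into I u))"
    using lmod_iso_trans[OF iso lmod_sum_reindex[OF bij mods]] by simp
  moreover have "\<forall>j\<in>u ` I. (F \<circ> inv_into I u) j \<in> \<X>"
    using F bij by (auto simp: bij_betw_def)
  ultimately show ?thesis
    using M unfolding semisimple_def by blast
qed

end

theory Submission
  imports Defs
begin

text \<open>Every nonzero homomorphism from a brick \<open>X\<close> of \<open>\<X>\<close> into an \<open>\<X>\<close>-semisimple module \<open>N\<close> has
  a retraction, because one of its coordinates is an automorphism of \<open>X\<close>. Splitting off images
  of bricks one at a time gives an exchange property: if \<open>V \<subseteq> N\<close> is a sum of images of bricks and
  a homomorphism \<open>h : X \<rightarrow> N\<close> maps some nonzero element into \<open>V\<close>, then it maps all of \<open>X\<close> into \<open>V\<close>.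
  So sets of summands behave as bases of vector spaces do. By Zorn's lemma some set of summands
  of \<open>M\<close> is maximal with the property that \<open>f\<close> is injective on their sum; it spans a complement of
  \<open>ker f\<close>, and \<open>ker f\<close> is isomorphic to the sum of the other summands. Likewise a maximal set of
  summands of \<open>N\<close> whose sum meets \<open>f M\<close> trivially spans a complement of \<open>f M\<close>, which is
  isomorphic to \<open>coker f\<close>.\<close>

subsection \<open>Homomorphisms of left modules\<close>

lemma left_module_abelian_group: "left_module R M \<Longrightarrow> abelian_group M"
  by (simp add: left_module_def)

lemma lmod_hom_closed: "h \<in> lmod_hom R M N \<Longrightarrow> x \<in> carrier M \<Longrightarrow> h x \<in> carrier N"
  by (auto simp: lmod_hom_def)

lemma lmod_hom_add:
  "h \<in> lmod_hom R M N \<Longrightarrow> x \<in> carrier M \<Longrightarrow> y \<in> carrier M \<Longrightarrow>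
   h (x \<oplus>\<^bsub>M\<^esub> y) = h x \<oplus>\<^bsub>N\<^esub> h y"
  by (auto simp: lmod_hom_def)

lemma lmod_hom_smult:
  "h \<in> lmod_hom R M N \<Longrightarrow> r \<in> carrier R \<Longrightarrow> x \<in> carrier M \<Longrightarrow>
   h (r \<odot>\<^bsub>M\<^esub> x) = r \<odot>\<^bsub>N\<^esub> h x"
  by (auto simp: lmod_hom_def)

lemma lmod_homI:
  assumes "\<And>x. x \<in> carrier M \<Longrightarrow> h x \<in> carrier N"
    and "\<And>x y. x \<in> carrier M \<Longrightarrow> y \<in> carrier M \<Longrightarrow> h (x \<oplus>\<^bsub>M\<^esub> y) = h x \<oplus>\<^bsub>N\<^esub> h y"
    and "\<And>r x. r \<in> carrier R \<Longrightarrow> x \<in> carrier M \<Longrightarrow> h (r \<odot>\<^bsub>M\<^esub> x) = r \<odot>\<^bsub>N\<^esub> h x"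
  shows "h \<in> lmod_hom R M N"
  using assms by (auto simp: lmod_hom_def)

lemma lmod_hom_comp:
  assumes "g \<in> lmod_hom R L M" "h \<in> lmod_hom R M N"
  shows "(\<lambda>x. h (g x)) \<in> lmod_hom R L N"
  using assms by (auto simp: lmod_hom_def Pi_iff)

lemma lmod_hom_zero:
  assumes "left_module R M" "left_module R N" "h \<in> lmod_hom R M N"
  shows "h \<zero>\<^bsub>M\<^esub> = \<zero>\<^bsub>N\<^esub>"
proof -
  interpret M: abelian_group M using assms(1) by (rule left_module_abelian_group)
  interpret N: abelian_group N using assms(2) by (rule left_module_abelian_group)
  have "h \<zero>\<^bsub>M\<^esub> \<oplus>\<^bsub>N\<^esub> h \<zero>\<^bsub>M\<^esub> = h \<zero>\<^bsub>M\<^esub> \<oplus>\<^bsub>N\<^esub> \<zero>\<^bsub>N\<^esub>"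
    using lmod_hom_add[OF assms(3), of "\<zero>\<^bsub>M\<^esub>" "\<zero>\<^bsub>M\<^esub>"] lmod_hom_closed[OF assms(3)] by simp
  then show ?thesis
    using lmod_hom_closed[OF assms(3)] by simp
qed

lemma lmod_hom_a_inv:
  assumes "left_module R M" "left_module R N" "h \<in> lmod_hom R M N" "x \<in> carrier M"
  shows "h (\<ominus>\<^bsub>M\<^esub> x) = \<ominus>\<^bsub>N\<^esub> h x"
proof -
  interpret M: abelian_group M using assms(1) by (rule left_module_abelian_group)
  interpret N: abelian_group N using assms(2) by (rule left_module_abelian_group)
  have "h (\<ominus>\<^bsub>M\<^esub> x) \<oplus>\<^bsub>N\<^esub> h x = \<zero>\<^bsub>N\<^esub>"
    using lmod_hom_add[OF assms(3), of "\<ominus>\<^bsub>M\<^esub> x" x] lmod_hom_zero[OF assms(1-3)] assms(4)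
    by (simp add: M.l_neg)
  then show ?thesis
    using N.minus_equality lmod_hom_closed[OF assms(3)] assms(4) by (metis M.a_inv_closed)
qed

lemma lmod_hom_minus:
  assumes "left_module R M" "left_module R N" "h \<in> lmod_hom R M N" "x \<in> carrier M" "y \<in> carrier M"
  shows "h (x \<ominus>\<^bsub>M\<^esub> y) = h x \<ominus>\<^bsub>N\<^esub> h y"
proof -
  interpret M: abelian_group M using assms(1) by (rule left_module_abelian_group)
  show ?thesis
    unfolding a_minus_def
    using lmod_hom_add[OF assms(3,4)] lmod_hom_a_inv[OF assms(1-3,5)] assms(5) by simp
qed

lemma (in abelian_group) minus_eq_zeroD:
  assumes "x \<in> carrier G" "y \<in> carrier G" "x \<ominus> y = \<zero>"
  shows "x = y"
proof -
  have "x = x \<oplus> (\<ominus> y \<oplus> y)"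
    using assms(1,2) by (simp add: l_neg)
  also have "\<dots> = x \<ominus> y \<oplus> y"
    using assms(1,2) by (simp add: a_minus_def a_assoc)
  finally show ?thesis
    using assms by simp
qed

lemma lmod_hom_inj_onI:
  assumes M: "left_module R M" and N: "left_module R N" and h: "h \<in> lmod_hom R M N"
    and ker: "\<And>x. x \<in> carrier M \<Longrightarrow> h x = \<zero>\<^bsub>N\<^esub> \<Longrightarrow> x = \<zero>\<^bsub>M\<^esub>"
  shows "inj_on h (carrier M)"
proof (rule inj_onI)
  interpret M: abelian_group M using M by (rule left_module_abelian_group)
  interpret N: abelian_group N using N by (rule left_module_abelian_group)
  fix x y assume xy: "x \<in> carrier M" "y \<in> carrier M" "h x = h y"
  then have "h (x \<ominus>\<^bsub>M\<^esub> y) = \<zero>\<^bsub>N\<^esub>"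
    using lmod_hom_minus[OF M N h] lmod_hom_closed[OF h] by (simp add: a_minus_def N.r_neg)
  then show "x = y"
    using ker xy M.minus_eq_zeroD by blast
qed

lemma lmod_hom_inv_into:
  assumes "left_module R M" and h: "h \<in> lmod_hom R M N" and bij: "bij_betw h (carrier M) (carrier N)"
  shows "inv_into (carrier M) h \<in> lmod_hom R N M"
proof -
  interpret left_module R M by fact
  have inv: "inv_into (carrier M) h y \<in> carrier M" "h (inv_into (carrier M) h y) = y"
    if "y \<in> carrier N" for y
    using that bij by (auto simp: bij_betw_def inv_into_into f_inv_into_f)
  have eq: "inv_into (carrier M) h y = x" if "x \<in> carrier M" "h x = y" for x y
    using that bij by (auto simp: bij_betw_def)
  show ?thesis
  proof (rule lmod_homI)
    fix x y assume "x \<in> carrier N" "y \<in> carrier N"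
    then show "inv_into (carrier M) h (x \<oplus>\<^bsub>N\<^esub> y) =
      inv_into (carrier M) h x \<oplus>\<^bsub>M\<^esub> inv_into (carrier M) h y"
      using inv by (intro eq) (simp_all add: lmod_hom_add[OF h])
  next
    fix r x assume "r \<in> carrier R" "x \<in> carrier N"
    then show "inv_into (carrier M) h (r \<odot>\<^bsub>N\<^esub> x) = r \<odot>\<^bsub>M\<^esub> inv_into (carrier M) h x"
      using inv by (intro eq) (simp_all add: lmod_hom_smult[OF h])
  qed (rule inv(1))
qed

lemma lmod_iso_sym:
  assumes "left_module R M" "lmod_iso R M N"
  shows "lmod_iso R N M"
  using assms lmod_hom_inv_into bij_betw_inv_into unfolding lmod_iso_def by blast

lemma left_module_surj_image:
  fixes M :: "('r, 'a) module" and N :: "('r, 'b) module"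
  assumes "left_module R M" and h: "h \<in> lmod_hom R M N" and surj: "h ` carrier M = carrier N"
    and zero: "h \<zero>\<^bsub>M\<^esub> = \<zero>\<^bsub>N\<^esub>"
  shows "left_module R N"
proof -
  interpret left_module R M by fact
  note hom = lmod_hom_closed[OF h] lmod_hom_add[OF h] lmod_hom_smult[OF h]
  have ex: "\<exists>a\<in>carrier M. x = h a" if "x \<in> carrier N" for x
    using that surj by auto
  have "abelian_group N"
  proof (rule abelian_groupI)
    fix x y z assume "x \<in> carrier N" "y \<in> carrier N" "z \<in> carrier N"
    then obtain a b c where "a \<in> carrier M" "b \<in> carrier M" "c \<in> carrier M" "x = h a" "y = h b" "z = h c"
      using ex by metis
    then show "x \<oplus>\<^bsub>N\<^esub> y \<oplus>\<^bsub>N\<^esub> z = x \<oplus>\<^bsub>N\<^esub> (y \<oplus>\<^bsub>N\<^esub> z)"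
      by (simp add: hom(2)[symmetric] M.a_assoc)
  next
    fix x y assume "x \<in> carrier N" "y \<in> carrier N"
    then obtain a b where "a \<in> carrier M" "b \<in> carrier M" "x = h a" "y = h b"
      using ex by metis
    then show "x \<oplus>\<^bsub>N\<^esub> y \<in> carrier N" "x \<oplus>\<^bsub>N\<^esub> y = y \<oplus>\<^bsub>N\<^esub> x"
      by (simp_all add: hom(2)[symmetric] M.a_comm) (simp add: hom(1))
  next
    fix x assume "x \<in> carrier N"
    then obtain a where a: "a \<in> carrier M" "x = h a"
      using ex by metis
    then show "\<zero>\<^bsub>N\<^esub> \<oplus>\<^bsub>N\<^esub> x = x"
      by (simp add: zero[symmetric] hom(2)[symmetric])
    have "h (\<ominus>\<^bsub>M\<^esub> a) \<oplus>\<^bsub>N\<^esub> x = \<zero>\<^bsub>N\<^esub>" "h (\<ominus>\<^bsub>M\<^esub> a) \<in> carrier N"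
      using a by (simp_all add: zero[symmetric] hom(2)[symmetric] M.l_neg) (simp add: hom(1))
    then show "\<exists>y\<in>carrier N. y \<oplus>\<^bsub>N\<^esub> x = \<zero>\<^bsub>N\<^esub>"
      by blast
  qed (use zero hom(1) in \<open>metis M.zero_closed\<close>)
  moreover have "left_module_axioms R N"
  proof (rule left_module_axioms.intro)
    fix a x assume "a \<in> carrier R" "x \<in> carrier N"
    then show "a \<odot>\<^bsub>N\<^esub> x \<in> carrier N"
      using ex by (metis hom(1,3) smult_closed)
  next
    fix a b x assume ab: "a \<in> carrier R" "b \<in> carrier R" and "x \<in> carrier N"
    then obtain m where m: "m \<in> carrier M" "x = h m"
      using ex by metis
    with ab show "(a \<oplus>\<^bsub>R\<^esub> b) \<odot>\<^bsub>N\<^esub> x = a \<odot>\<^bsub>N\<^esub> x \<oplus>\<^bsub>N\<^esub> b \<odot>\<^bsub>N\<^esub> x"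
      by (simp add: hom(2,3)[symmetric] smult_l_distr)
    from m ab show "(a \<otimes>\<^bsub>R\<^esub> b) \<odot>\<^bsub>N\<^esub> x = a \<odot>\<^bsub>N\<^esub> (b \<odot>\<^bsub>N\<^esub> x)"
      by (simp add: hom(3)[symmetric] smult_assoc1)
  next
    fix a x y assume a: "a \<in> carrier R" and "x \<in> carrier N" "y \<in> carrier N"
    then obtain m n where "m \<in> carrier M" "x = h m" "n \<in> carrier M" "y = h n"
      using ex by metis
    with a show "a \<odot>\<^bsub>N\<^esub> (x \<oplus>\<^bsub>N\<^esub> y) = a \<odot>\<^bsub>N\<^esub> x \<oplus>\<^bsub>N\<^esub> a \<odot>\<^bsub>N\<^esub> y"
      by (simp add: hom(2,3)[symmetric] smult_r_distr)
  next
    fix x assume "x \<in> carrier N"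
    then obtain m where "m \<in> carrier M" "x = h m"
      using ex by metis
    then show "\<one>\<^bsub>R\<^esub> \<odot>\<^bsub>N\<^esub> x = x"
      by (simp add: hom(3)[symmetric])
  qed
  ultimately show ?thesis
    using ring_axioms by (simp add: left_module_def)
qed

subsection \<open>Direct sums\<close>

definition sum_ext :: "'i set \<Rightarrow> 'i set \<Rightarrow> ('i \<Rightarrow> ('r, 'a) module) \<Rightarrow> ('i \<Rightarrow> 'a) \<Rightarrow> 'i \<Rightarrow> 'a" where
  "sum_ext I L F x = (\<lambda>j\<in>I. if j \<in> L then x j else \<zero>\<^bsub>F j\<^esub>)"

lemma lmod_sum_memI:
  assumes "x \<in> extensional I" "\<And>i. i \<in> I \<Longrightarrow> x i \<in> carrier (F i)"
    and "finite {i \<in> I. x i \<noteq> \<zero>\<^bsub>F i\<^esub>}"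
  shows "x \<in> carrier (lmod_sum I F)"
  using assms by (auto simp: lmod_sum_def PiE_iff)

lemma lmod_sum_memD:
  assumes "x \<in> carrier (lmod_sum I F)"
  shows "x \<in> extensional I" "\<And>i. i \<in> I \<Longrightarrow> x i \<in> carrier (F i)"
    and "finite {i \<in> I. x i \<noteq> \<zero>\<^bsub>F i\<^esub>}"
  using assms by (auto simp: lmod_sum_def PiE_iff)

lemma lmod_sum_sel:
  "\<zero>\<^bsub>lmod_sum I F\<^esub> = (\<lambda>i\<in>I. \<zero>\<^bsub>F i\<^esub>)"
  "x \<oplus>\<^bsub>lmod_sum I F\<^esub> y = (\<lambda>i\<in>I. x i \<oplus>\<^bsub>F i\<^esub> y i)"
  "r \<odot>\<^bsub>lmod_sum I F\<^esub> x = (\<lambda>i\<in>I. r \<odot>\<^bsub>F i\<^esub> x i)"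
  by (simp_all add: lmod_sum_def)

lemma left_module_smult_zero:
  assumes "left_module R M" "r \<in> carrier R"
  shows "r \<odot>\<^bsub>M\<^esub> \<zero>\<^bsub>M\<^esub> = \<zero>\<^bsub>M\<^esub>"
proof -
  interpret left_module R M by fact
  have "r \<odot>\<^bsub>M\<^esub> \<zero>\<^bsub>M\<^esub> \<oplus>\<^bsub>M\<^esub> r \<odot>\<^bsub>M\<^esub> \<zero>\<^bsub>M\<^esub> = r \<odot>\<^bsub>M\<^esub> \<zero>\<^bsub>M\<^esub> \<oplus>\<^bsub>M\<^esub> \<zero>\<^bsub>M\<^esub>"
    using assms(2) smult_r_distr[of r "\<zero>\<^bsub>M\<^esub>" "\<zero>\<^bsub>M\<^esub>"] by simp
  then show ?thesis
    using assms(2) by simp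
qed

lemma left_module_lmod_sum:
  assumes "ring R" and mod: "\<And>i. i \<in> I \<Longrightarrow> left_module R (F i)"
  shows "left_module R (lmod_sum I F)"
proof -
  interpret ring R by fact
  let ?S = "lmod_sum I F"
  have ab: "abelian_group (F i)" if "i \<in> I" for i
    using mod[OF that] by (rule left_module_abelian_group)
  note am = abelian_group.axioms(1)[OF ab]
  note [simp] = abelian_monoid.zero_closed[OF am] abelian_monoid.a_closed[OF am] abelian_monoid.l_zero[OF am]
    abelian_group.a_inv_closed[OF ab] abelian_group.l_neg[OF ab] left_module.smult_closed[OF mod]
    left_module_smult_zero[OF mod] left_module.smult_one[OF mod]
  have add: "x \<oplus>\<^bsub>?S\<^esub> y \<in> carrier ?S" if "x \<in> carrier ?S" "y \<in> carrier ?S" for x y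
  proof (rule lmod_sum_memI)
    show "finite {i \<in> I. (x \<oplus>\<^bsub>?S\<^esub> y) i \<noteq> \<zero>\<^bsub>F i\<^esub>}"
      using lmod_sum_memD(3)[OF that(1)] lmod_sum_memD(3)[OF that(2)]
      by (rule finite_subset[rotated, OF finite_UnI]) (auto simp: lmod_sum_sel)
  qed (use that[THEN lmod_sum_memD(2)] in \<open>auto simp: lmod_sum_sel\<close>)
  have smult: "r \<odot>\<^bsub>?S\<^esub> x \<in> carrier ?S" if "r \<in> carrier R" "x \<in> carrier ?S" for r x
  proof (rule lmod_sum_memI)
    show "finite {i \<in> I. (r \<odot>\<^bsub>?S\<^esub> x) i \<noteq> \<zero>\<^bsub>F i\<^esub>}"
      using lmod_sum_memD(3)[OF that(2)]
      by (rule finite_subset[rotated]) (use that in \<open>auto simp: lmod_sum_sel\<close>)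
  qed (use that lmod_sum_memD(2)[OF that(2)] in \<open>auto simp: lmod_sum_sel\<close>)
  have neg: "(\<lambda>i\<in>I. \<ominus>\<^bsub>F i\<^esub> x i) \<in> carrier ?S" if "x \<in> carrier ?S" for x
  proof (rule lmod_sum_memI)
    have "\<ominus>\<^bsub>F i\<^esub> \<zero>\<^bsub>F i\<^esub> = \<zero>\<^bsub>F i\<^esub>" if "i \<in> I" for i
    proof -
      interpret abelian_group "F i" using ab[OF that] .
      show ?thesis using add.inv_one by (simp add: a_inv_def)
    qed
    then show "finite {i \<in> I. (\<lambda>i\<in>I. \<ominus>\<^bsub>F i\<^esub> x i) i \<noteq> \<zero>\<^bsub>F i\<^esub>}"
      by (intro finite_subset[OF _ lmod_sum_memD(3)[OF that]]) auto
  qed (use lmod_sum_memD(2)[OF that] in auto)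
  have "abelian_group ?S"
  proof (rule abelian_groupI)
    show "\<zero>\<^bsub>?S\<^esub> \<in> carrier ?S"
      by (rule lmod_sum_memI) (auto simp: lmod_sum_sel)
    fix x assume x: "x \<in> carrier ?S"
    then show "\<zero>\<^bsub>?S\<^esub> \<oplus>\<^bsub>?S\<^esub> x = x"
      using lmod_sum_memD[OF x] by (auto simp: lmod_sum_sel intro!: extensionalityI[of _ I])
    show "\<exists>y\<in>carrier ?S. y \<oplus>\<^bsub>?S\<^esub> x = \<zero>\<^bsub>?S\<^esub>"
      using neg[OF x] lmod_sum_memD(2)[OF x]
      by (intro bexI[of _ "\<lambda>i\<in>I. \<ominus>\<^bsub>F i\<^esub> x i"]) (auto simp: lmod_sum_sel)
  next
    fix x y z assume "x \<in> carrier ?S" "y \<in> carrier ?S" "z \<in> carrier ?S"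
    note * = this[THEN lmod_sum_memD(2)]
    show "x \<oplus>\<^bsub>?S\<^esub> y \<oplus>\<^bsub>?S\<^esub> z = x \<oplus>\<^bsub>?S\<^esub> (y \<oplus>\<^bsub>?S\<^esub> z)"
      using * abelian_monoid.a_assoc[OF am] by (auto simp: lmod_sum_sel)
    show "x \<oplus>\<^bsub>?S\<^esub> y = y \<oplus>\<^bsub>?S\<^esub> x"
      using * abelian_monoid.a_comm[OF am] by (auto simp: lmod_sum_sel)
  qed (rule add)
  moreover have "left_module_axioms R ?S"
  proof (rule left_module_axioms.intro)
    fix a b x assume ab: "a \<in> carrier R" "b \<in> carrier R" and "x \<in> carrier ?S"
    note * = lmod_sum_memD(2)[OF this(3)]
    show "(a \<oplus>\<^bsub>R\<^esub> b) \<odot>\<^bsub>?S\<^esub> x = a \<odot>\<^bsub>?S\<^esub> x \<oplus>\<^bsub>?S\<^esub> b \<odot>\<^bsub>?S\<^esub> x"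
      using * ab left_module.smult_l_distr[OF mod] by (auto simp: lmod_sum_sel)
    show "(a \<otimes>\<^bsub>R\<^esub> b) \<odot>\<^bsub>?S\<^esub> x = a \<odot>\<^bsub>?S\<^esub> (b \<odot>\<^bsub>?S\<^esub> x)"
      using * ab left_module.smult_assoc1[OF mod] by (auto simp: lmod_sum_sel)
  next
    fix a x y assume a: "a \<in> carrier R" and "x \<in> carrier ?S" "y \<in> carrier ?S"
    note * = this(2,3)[THEN lmod_sum_memD(2)]
    show "a \<odot>\<^bsub>?S\<^esub> (x \<oplus>\<^bsub>?S\<^esub> y) = a \<odot>\<^bsub>?S\<^esub> x \<oplus>\<^bsub>?S\<^esub> a \<odot>\<^bsub>?S\<^esub> y"
      using * a left_module.smult_r_distr[OF mod] by (auto simp: lmod_sum_sel)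
  next
    fix x assume x: "x \<in> carrier ?S"
    show "\<one>\<^bsub>R\<^esub> \<odot>\<^bsub>?S\<^esub> x = x"
      using lmod_sum_memD[OF x] by (auto simp: lmod_sum_sel intro!: extensionalityI[of _ I])
  qed (rule smult)
  ultimately show ?thesis
    using \<open>ring R\<close> by (simp add: left_module_def)
qed

lemma lmod_sum_proj_hom: "i \<in> I \<Longrightarrow> (\<lambda>x. x i) \<in> lmod_hom R (lmod_sum I F) (F i)"
  by (auto simp: lmod_hom_def lmod_sum_def)

lemma lmod_sum_restrict_hom:
  assumes "L \<subseteq> I"
  shows "(\<lambda>x. restrict x L) \<in> lmod_hom R (lmod_sum I F) (lmod_sum L F)"
proof (rule lmod_homI)
  fix x assume x: "x \<in> carrier (lmod_sum I F)"
  show "restrict x L \<in> carrier (lmod_sum L F)"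
  proof (rule lmod_sum_memI)
    show "finite {i \<in> L. restrict x L i \<noteq> \<zero>\<^bsub>F i\<^esub>}"
      using lmod_sum_memD(3)[OF x] by (rule finite_subset[rotated]) (use assms in auto)
  qed (use lmod_sum_memD[OF x] assms in auto)
qed (use assms in \<open>auto simp: lmod_sum_sel fun_eq_iff\<close>)

lemma sum_ext_mem:
  assumes mod: "\<And>i. i \<in> I \<Longrightarrow> left_module R (F i)"
    and "\<And>i. i \<in> L \<Longrightarrow> x i \<in> carrier (F i)" "finite {i \<in> I \<inter> L. x i \<noteq> \<zero>\<^bsub>F i\<^esub>}"
  shows "sum_ext I L F x \<in> carrier (lmod_sum I F)"
proof (rule lmod_sum_memI)
  have "\<zero>\<^bsub>F i\<^esub> \<in> carrier (F i)" if "i \<in> I" for i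
    using mod[OF that] by (simp add: left_module_def abelian_group_def abelian_monoid.zero_closed)
  then show "sum_ext I L F x i \<in> carrier (F i)" if "i \<in> I" for i
    using assms(2) that by (auto simp: sum_ext_def)
  show "finite {i \<in> I. sum_ext I L F x i \<noteq> \<zero>\<^bsub>F i\<^esub>}"
    using assms(3) by (rule finite_subset[rotated]) (auto simp: sum_ext_def)
qed (auto simp: sum_ext_def)

lemma sum_ext_add:
  assumes mod: "\<And>i. i \<in> I \<Longrightarrow> left_module R (F i)" and "L \<subseteq> I"
  shows "sum_ext I L F (\<lambda>i\<in>L. x i \<oplus>\<^bsub>F i\<^esub> y i) = sum_ext I L F x \<oplus>\<^bsub>lmod_sum I F\<^esub> sum_ext I L F y"
proof -
  have "\<zero>\<^bsub>F i\<^esub> \<oplus>\<^bsub>F i\<^esub> \<zero>\<^bsub>F i\<^esub> = \<zero>\<^bsub>F i\<^esub>" if "i \<in> I" for i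
    using mod[OF that] by (simp add: left_module_def abelian_group_def abelian_monoid.zero_closed abelian_monoid.l_zero)
  then show ?thesis
    using assms(2) by (auto simp: sum_ext_def lmod_sum_sel fun_eq_iff)
qed

lemma sum_ext_hom:
  assumes mod: "\<And>i. i \<in> I \<Longrightarrow> left_module R (F i)" and "L \<subseteq> I"
  shows "sum_ext I L F \<in> lmod_hom R (lmod_sum L F) (lmod_sum I F)"
proof (rule lmod_homI)
  fix x assume x: "x \<in> carrier (lmod_sum L F)"
  have "I \<inter> L = L" using assms(2) by auto
  then show "sum_ext I L F x \<in> carrier (lmod_sum I F)"
    using lmod_sum_memD[OF x] by (intro sum_ext_mem[OF mod]) auto
  fix r assume "r \<in> carrier R"
  then show "sum_ext I L F (r \<odot>\<^bsub>lmod_sum L F\<^esub> x) = r \<odot>\<^bsub>lmod_sum I F\<^esub> sum_ext I L F x"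
    using assms(2) left_module_smult_zero[OF mod] by (auto simp: sum_ext_def lmod_sum_sel fun_eq_iff)
qed (use sum_ext_add[OF assms] in \<open>simp add: lmod_sum_sel\<close>)

lemma sum_ext_singleton_hom:
  assumes mod: "\<And>i. i \<in> I \<Longrightarrow> left_module R (F i)" and "i \<in> I"
  shows "(\<lambda>a. sum_ext I {i} F (\<lambda>_. a)) \<in> lmod_hom R (F i) (lmod_sum I F)"
proof -
  have fin: "finite {j \<in> {i}. Q j}" for Q
    by simp
  have "(\<lambda>a. \<lambda>_\<in>{i}. a) \<in> lmod_hom R (F i) (lmod_sum {i} F)"
    by (rule lmod_homI) (auto simp: lmod_sum_sel fin intro!: lmod_sum_memI)
  from lmod_hom_comp[OF this sum_ext_hom[OF mod]]
  have "(\<lambda>a. sum_ext I {i} F (\<lambda>_\<in>{i}. a)) \<in> lmod_hom R (F i) (lmod_sum I F)"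
    using assms(2) by simp
  moreover have "(\<lambda>a. sum_ext I {i} F (\<lambda>_\<in>{i}. a)) = (\<lambda>a. sum_ext I {i} F (\<lambda>_. a))"
    by (auto simp: sum_ext_def fun_eq_iff)
  ultimately show ?thesis by simp
qed

lemma sum_ext_split:
  assumes mod: "\<And>i. i \<in> I \<Longrightarrow> left_module R (F i)" and x: "x \<in> carrier (lmod_sum I F)"
    and supp: "{j \<in> I. x j \<noteq> \<zero>\<^bsub>F j\<^esub>} \<subseteq> insert i L" and "i \<in> I" "i \<notin> L"
  shows "x = sum_ext I {i} F (\<lambda>_. x i) \<oplus>\<^bsub>lmod_sum I F\<^esub> sum_ext I L F x"
proof (rule extensionalityI[of _ I])
  fix j assume j: "j \<in> I"
  interpret abelian_group "F j" using mod[OF j] by (rule left_module_abelian_group)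
  have "x j \<oplus>\<^bsub>F j\<^esub> \<zero>\<^bsub>F j\<^esub> = x j" "\<zero>\<^bsub>F j\<^esub> \<oplus>\<^bsub>F j\<^esub> x j = x j"
    using lmod_sum_memD(2)[OF x j] by simp_all
  then show "x j = (sum_ext I {i} F (\<lambda>_. x i) \<oplus>\<^bsub>lmod_sum I F\<^esub> sum_ext I L F x) j"
    using j assms(4,5) supp lmod_sum_memD(2)[OF x j]
    by (cases "j = i") (auto simp: sum_ext_def lmod_sum_sel)
qed (use lmod_sum_memD(1)[OF x] in \<open>auto simp: lmod_sum_sel\<close>)

lemma lmod_sum_induct:
  assumes mod: "\<And>i. i \<in> I \<Longrightarrow> left_module R (F i)" and x: "x \<in> carrier (lmod_sum I F)"
    and zero: "Q \<zero>\<^bsub>lmod_sum I F\<^esub>"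
    and single: "\<And>i a. i \<in> I \<Longrightarrow> a \<in> carrier (F i) \<Longrightarrow> Q (sum_ext I {i} F (\<lambda>_. a))"
    and add: "\<And>x y. x \<in> carrier (lmod_sum I F) \<Longrightarrow> y \<in> carrier (lmod_sum I F) \<Longrightarrow> Q x \<Longrightarrow> Q y \<Longrightarrow>
       Q (x \<oplus>\<^bsub>lmod_sum I F\<^esub> y)"
  shows "Q x"
proof -
  let ?supp = "\<lambda>x. {i \<in> I. x i \<noteq> \<zero>\<^bsub>F i\<^esub>}"
  have "\<forall>x\<in>carrier (lmod_sum I F). ?supp x \<subseteq> A \<longrightarrow> Q x" if "finite A" "A \<subseteq> I" for A
    using that
  proof (induction A)
    case empty
    have "x = \<zero>\<^bsub>lmod_sum I F\<^esub>" if "x \<in> carrier (lmod_sum I F)" "?supp x \<subseteq> {}" for x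
      using that lmod_sum_memD(1)[OF that(1)] by (auto simp: lmod_sum_sel intro!: extensionalityI[of _ I])
    then show ?case using zero by blast
  next
    case (insert i A)
    show ?case
    proof (intro ballI impI)
      fix x assume x: "x \<in> carrier (lmod_sum I F)" "?supp x \<subseteq> insert i A"
      have i: "i \<in> I" using insert.prems by simp
      have r: "sum_ext I A F x \<in> carrier (lmod_sum I F)"
        using lmod_sum_memD[OF x(1)] insert.prems insert.hyps
        by (intro sum_ext_mem[OF mod]) auto
      moreover have "?supp (sum_ext I A F x) \<subseteq> A"
        by (auto simp: sum_ext_def)
      ultimately have "Q (sum_ext I A F x)"
        using insert by blast
      moreover have "sum_ext I {i} F (\<lambda>_. x i) \<in> carrier (lmod_sum I F)"
        using lmod_hom_closed[OF sum_ext_singleton_hom[OF mod i]] lmod_sum_memD(2)[OF x(1) i] by simp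
      ultimately have "Q (sum_ext I {i} F (\<lambda>_. x i) \<oplus>\<^bsub>lmod_sum I F\<^esub> sum_ext I A F x)"
        using add single[OF i lmod_sum_memD(2)[OF x(1) i]] r by blast
      then show "Q x"
        using sum_ext_split[OF mod x(1,2) i] insert.hyps by simp
    qed
  qed
  from this[OF lmod_sum_memD(3)[OF x]] show ?thesis
    using x by blast
qed

subsection \<open>Sums of images of bricks\<close>

lemma brick_hom_nonzero_inverse:
  assumes X: "brick R X" and g: "g \<in> lmod_hom R X X" "\<not> zero_map X X g"
  shows "\<exists>u\<in>lmod_hom R X X. \<forall>x\<in>carrier X. u (g x) = x"
proof -
  let ?E = "lmod_End R X"
  interpret skew_field ?E
    using X by (simp add: brick_def)
  let ?g = "restrict g (carrier X)"
  interpret X: left_module R X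
    using X by (simp add: brick_def)
  have "?g \<in> carrier ?E"
    using g(1) by (auto simp: lmod_End_def lmod_hom_def)
  moreover have "?g \<noteq> \<zero>\<^bsub>?E\<^esub>"
    using g(2) by (auto simp: lmod_End_def zero_map_def fun_eq_iff)
  ultimately have "?g \<in> Units ?E"
    using skew_field_Units by auto
  then obtain u where u: "u \<in> carrier ?E" "u \<otimes>\<^bsub>?E\<^esub> ?g = \<one>\<^bsub>?E\<^esub>"
    by (auto simp: Units_def)
  have "u (g x) = x" if "x \<in> carrier X" for x
    using fun_cong[OF u(2), of x] that by (simp add: lmod_End_def compose_def)
  then show ?thesis
    using u(1) by (auto simp: lmod_End_def)
qed

definition brick_homs_split ::
    "('r, 'e) ring_scheme \<Rightarrow> ('r, 'x) module set \<Rightarrow> ('r, 'n) module \<Rightarrow> bool" where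
  "brick_homs_split R \<X> N \<longleftrightarrow>
     (\<forall>X\<in>\<X>. \<forall>g\<in>lmod_hom R X N. \<not> zero_map X N g \<longrightarrow>
        (\<exists>r\<in>lmod_hom R N X. \<forall>x\<in>carrier X. r (g x) = x))"

lemma brick_homs_splitD:
  assumes "brick_homs_split R \<X> N" "X \<in> \<X>" "g \<in> lmod_hom R X N" "\<not> zero_map X N g"
  obtains r where "r \<in> lmod_hom R N X" "\<And>x. x \<in> carrier X \<Longrightarrow> r (g x) = x"
  using assms unfolding brick_homs_split_def by blast

lemma semibrickD:
  assumes "semibrick R \<X>" "X \<in> \<X>"
  shows "brick R X"
    and "Y \<in> \<X> \<Longrightarrow> X \<noteq> Y \<Longrightarrow> h \<in> lmod_hom R X Y \<Longrightarrow> zero_map X Y h"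
  using assms unfolding semibrick_def by blast+

lemma semibrick_left_module: "semibrick R \<X> \<Longrightarrow> X \<in> \<X> \<Longrightarrow> left_module R X"
  by (auto simp: semibrick_def brick_def)

lemma brick_homs_split_if_embeds:
  assumes \<X>: "semibrick R \<X>" and N: "left_module R N" and G: "\<And>j. j \<in> J \<Longrightarrow> G j \<in> \<X>"
    and p: "p \<in> lmod_hom R N (lmod_sum J G)" "inj_on p (carrier N)"
  shows "brick_homs_split R \<X> N"
  unfolding brick_homs_split_def
proof (intro ballI impI)
  fix X g assume X: "X \<in> \<X>" and g: "g \<in> lmod_hom R X N" and nz: "\<not> zero_map X N g"
  have modS: "left_module R (lmod_sum J G)"
    using N by (intro left_module_lmod_sum semibrick_left_module[OF \<X>] G) (simp add: left_module_def)
  interpret N: abelian_group N using N by (rule left_module_abelian_group)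
  obtain x where x: "x \<in> carrier X" "g x \<noteq> \<zero>\<^bsub>N\<^esub>"
    using nz by (auto simp: zero_map_def)
  have "p (g x) \<noteq> p \<zero>\<^bsub>N\<^esub>"
    using inj_onD[OF p(2), of "g x" "\<zero>\<^bsub>N\<^esub>"] lmod_hom_closed[OF g x(1)] x(2) by auto
  then have ne: "p (g x) \<noteq> \<zero>\<^bsub>lmod_sum J G\<^esub>"
    by (simp add: lmod_hom_zero[OF N modS p(1)])
  have "p (g x) \<in> extensional J"
    using lmod_sum_memD(1)[OF lmod_hom_closed[OF p(1) lmod_hom_closed[OF g x(1)]]] .
  then have "\<exists>j\<in>J. p (g x) j \<noteq> \<zero>\<^bsub>lmod_sum J G\<^esub> j"
    using ne extensionalityI[of "p (g x)" J "\<zero>\<^bsub>lmod_sum J G\<^esub>"]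
    by (metis lmod_sum_sel(1) restrict_extensional)
  then obtain j where j: "j \<in> J" "p (g x) j \<noteq> \<zero>\<^bsub>G j\<^esub>"
    by (auto simp: lmod_sum_sel)
  have pj: "(\<lambda>n. p n j) \<in> lmod_hom R N (G j)"
    using lmod_hom_comp[OF p(1) lmod_sum_proj_hom[OF j(1)]] .
  have hom: "(\<lambda>x. p (g x) j) \<in> lmod_hom R X (G j)"
    using lmod_hom_comp[OF g pj] .
  have nz': "\<not> zero_map X (G j) (\<lambda>x. p (g x) j)"
    using j(2) x(1) by (auto simp: zero_map_def)
  then have eq: "G j = X"
    using semibrickD(2)[OF \<X> X G[OF j(1)] _ hom] by metis
  obtain u where u: "u \<in> lmod_hom R X X" "\<And>x. x \<in> carrier X \<Longrightarrow> u (p (g x) j) = x"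
    using brick_hom_nonzero_inverse[OF semibrickD(1)[OF \<X> X] hom[unfolded eq] nz'[unfolded eq]] by auto
  show "\<exists>r\<in>lmod_hom R N X. \<forall>x\<in>carrier X. r (g x) = x"
    using lmod_hom_comp[OF pj[unfolded eq] u(1)] u(2) by (intro bexI[of _ "\<lambda>n. u (p n j)"]) auto
qed

inductive_set brick_sums ::
    "('r, 'e) ring_scheme \<Rightarrow> ('r, 'x) module set \<Rightarrow> ('r, 'n) module \<Rightarrow> 'n set set"
  for R \<X> N where
  zero: "{\<zero>\<^bsub>N\<^esub>} \<in> brick_sums R \<X> N"
| add: "W \<in> brick_sums R \<X> N \<Longrightarrow> X \<in> \<X> \<Longrightarrow> g \<in> lmod_hom R X N \<Longrightarrow>
        W <+>\<^bsub>N\<^esub> g ` carrier X \<in> brick_sums R \<X> N"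

lemma set_add_memI: "a \<in> A \<Longrightarrow> b \<in> B \<Longrightarrow> a \<oplus>\<^bsub>N\<^esub> b \<in> A <+>\<^bsub>N\<^esub> B"
  by (auto simp: set_add_def')

lemma set_add_memE:
  assumes "c \<in> A <+>\<^bsub>N\<^esub> B"
  obtains a b where "a \<in> A" "b \<in> B" "c = a \<oplus>\<^bsub>N\<^esub> b"
  using assms by (auto simp: set_add_def')

lemma brick_sums_subset:
  assumes N: "left_module R N" and "W \<in> brick_sums R \<X> N"
  shows "W \<subseteq> carrier N"
  using assms(2)
proof induction
  interpret N: abelian_group N using N by (rule left_module_abelian_group)
  case zero
  show ?case by simp
next
  interpret N: abelian_group N using N by (rule left_module_abelian_group)
  case (add W X g)
  then show ?case
    using lmod_hom_closed[OF add(3)] by (auto elim!: set_add_memE)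
qed

lemma brick_sums_set_add:
  assumes N: "left_module R N" and V: "V \<in> brick_sums R \<X> N" and "W \<in> brick_sums R \<X> N"
  shows "V <+>\<^bsub>N\<^esub> W \<in> brick_sums R \<X> N"
  using assms(3)
proof induction
  interpret N: abelian_group N using N by (rule left_module_abelian_group)
  have sub: "V \<subseteq> carrier N"
    using brick_sums_subset[OF N V] .
  { case zero
    have "V <+>\<^bsub>N\<^esub> {\<zero>\<^bsub>N\<^esub>} = V"
      using sub by (force simp: set_add_def')
    then show ?case using V by simp }
  { case (add W X g)
    have "V <+>\<^bsub>N\<^esub> (W <+>\<^bsub>N\<^esub> g ` carrier X) = (V <+>\<^bsub>N\<^esub> W) <+>\<^bsub>N\<^esub> g ` carrier X"
      using N.add.set_mult_assoc[OF sub brick_sums_subset[OF N add(1)], of "g ` carrier X"]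
        lmod_hom_closed[OF add(3)] by (auto simp: set_add_def)
    then show ?case
      using brick_sums.add[OF add(4,2,3)] by simp }
qed

text \<open>The induction is over the number of bricks in the sum: composing with
  \<open>n \<mapsto> n \<ominus> g (r n)\<close>, where \<open>r\<close> is a retraction of \<open>g\<close>, kills exactly the
  image of \<open>g\<close>. The endomorphism \<open>P\<close> accumulates these maps.\<close>

lemma brick_sums_saturated_aux:
  assumes \<X>: "\<And>X. X \<in> \<X> \<Longrightarrow> left_module R X" and N: "left_module R N" and split: "brick_homs_split R \<X> N"
    and "W \<in> brick_sums R \<X> N" and P: "P \<in> lmod_hom R N N"
    and X: "X \<in> \<X>" and h: "h \<in> lmod_hom R X N"
    and x: "x \<in> carrier X" "x \<noteq> \<zero>\<^bsub>X\<^esub>" "h x \<in> P ` W"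
  shows "h ` carrier X \<subseteq> P ` W"
  using assms(4) P h x(3)
proof (induction arbitrary: P h)
  case zero
  note P0 = lmod_hom_zero[OF N N zero(1)]
  have "zero_map X N h"
  proof (rule ccontr)
    assume "\<not> zero_map X N h"
    from brick_homs_splitD[OF split X zero(2) this]
    obtain r where r: "r \<in> lmod_hom R N X" "\<And>x. x \<in> carrier X \<Longrightarrow> r (h x) = x"
      by blast
    then show False
      using zero(3) x(1,2) lmod_hom_zero[OF N \<X>[OF X] r(1)] P0 by force
  qed
  then show ?case
    using P0 by (auto simp: zero_map_def)
next
  case (add W Y g)
  interpret N: abelian_group N using N by (rule left_module_abelian_group)
  interpret Y: abelian_group Y using \<X>[OF add(2)] by (rule left_module_abelian_group)
  have W: "W \<subseteq> carrier N" using brick_sums_subset[OF N add(1)] .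
  have Pg: "(\<lambda>y. P (g y)) \<in> lmod_hom R Y N"
    using lmod_hom_comp[OF add(3,5)] .
  have image: "P w \<oplus>\<^bsub>N\<^esub> P (g y) \<in> P ` (W <+>\<^bsub>N\<^esub> g ` carrier Y)" if "w \<in> W" "y \<in> carrier Y" for w y
    using that W lmod_hom_closed[OF add(3)] by (subst lmod_hom_add[OF add(5), symmetric]) (auto intro: set_add_memI)
  obtain w y where wy: "w \<in> W" "y \<in> carrier Y" "h x = P w \<oplus>\<^bsub>N\<^esub> P (g y)"
    using add(7) lmod_hom_closed[OF add(3)] lmod_hom_add[OF add(5)] W by (auto elim!: set_add_memE)
  note cl = lmod_hom_closed[OF add(3)] lmod_hom_closed[OF add(5)] lmod_hom_closed[OF add(6)]
  show ?case
  proof (cases "zero_map Y N (\<lambda>y. P (g y))")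
    case True
    then have "h x \<in> P ` W"
      using wy W cl by (auto simp: zero_map_def)
    then have "h ` carrier X \<subseteq> P ` W"
      using add by blast
    moreover have "P w \<in> P ` (W <+>\<^bsub>N\<^esub> g ` carrier Y)" if "w \<in> W" for w
    proof -
      have "P (g \<zero>\<^bsub>Y\<^esub>) = \<zero>\<^bsub>N\<^esub>"
        using True by (simp add: zero_map_def)
      moreover have "P w \<in> carrier N"
        using that W cl(2) by blast
      ultimately show ?thesis
        using image[OF that Y.zero_closed] by simp
    qed
    then have "P ` W \<subseteq> P ` (W <+>\<^bsub>N\<^esub> g ` carrier Y)"
      by (rule image_subsetI)
    ultimately show ?thesis by (rule order_trans)
  next
    case False
    from brick_homs_splitD[OF split add(2) Pg this]
    obtain r where r: "r \<in> lmod_hom R N Y" "\<And>y. y \<in> carrier Y \<Longrightarrow> r (P (g y)) = y"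
      by blast
    note rc = lmod_hom_closed[OF r(1)]
    define Q where "Q = (\<lambda>n. n \<ominus>\<^bsub>N\<^esub> P (g (r n)))"
    have Pgr: "(\<lambda>n. P (g (r n))) \<in> lmod_hom R N N"
      using lmod_hom_comp[OF r(1) Pg] .
    have Q: "Q \<in> lmod_hom R N N"
    proof (rule lmod_homI)
      fix a m assume am: "a \<in> carrier R" "m \<in> carrier N"
      interpret left_module R N by fact
      have "a \<odot>\<^bsub>N\<^esub> (\<ominus>\<^bsub>N\<^esub> z) = \<ominus>\<^bsub>N\<^esub> (a \<odot>\<^bsub>N\<^esub> z)" if "z \<in> carrier N" for z
        using am(1) that smult_r_distr[of a "\<ominus>\<^bsub>N\<^esub> z" z] left_module_smult_zero[OF N am(1)]
        by (intro N.minus_equality[symmetric]) (simp_all add: N.l_neg)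
      then show "Q (a \<odot>\<^bsub>N\<^esub> m) = a \<odot>\<^bsub>N\<^esub> Q m"
        using am lmod_hom_smult[OF Pgr am] lmod_hom_closed[OF Pgr am(2)]
        by (simp add: Q_def a_minus_def smult_r_distr)
    next
      fix m n assume mn: "m \<in> carrier N" "n \<in> carrier N"
      show "Q (m \<oplus>\<^bsub>N\<^esub> n) = Q m \<oplus>\<^bsub>N\<^esub> Q n"
        using mn lmod_hom_add[OF Pgr mn] lmod_hom_closed[OF Pgr]
        by (simp add: Q_def a_minus_def N.minus_add N.a_ac)
    qed (simp add: Q_def lmod_hom_closed[OF Pgr])
    have QPg: "Q (P (g y)) = \<zero>\<^bsub>N\<^esub>" if "y \<in> carrier Y" for y
      using r(2)[OF that] that cl by (simp add: Q_def a_minus_def N.r_neg)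
    have "Q (h x) = Q (P w)"
      using wy W cl QPg[OF wy(2)] lmod_hom_add[OF Q] lmod_hom_closed[OF Q] by (simp add: subset_eq)
    then have "(\<lambda>n. Q (P n)) \<in> lmod_hom R N N" "(\<lambda>z. Q (h z)) \<in> lmod_hom R X N" "Q (h x) \<in> (\<lambda>n. Q (P n)) ` W"
      using lmod_hom_comp[OF add(5) Q] lmod_hom_comp[OF add(6) Q] wy(1) by auto
    from add.IH[OF this] have IH: "(\<lambda>z. Q (h z)) ` carrier X \<subseteq> (\<lambda>n. Q (P n)) ` W" .
    show ?thesis
    proof
      fix n assume "n \<in> h ` carrier X"
      then obtain z where z: "z \<in> carrier X" "n = h z" by blast
      then obtain v where v: "v \<in> W" "Q n = Q (P v)"
        using IH by auto
      have n: "n \<in> carrier N" and Pv: "P v \<in> carrier N" using z v W cl by auto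
      define d where "d = n \<ominus>\<^bsub>N\<^esub> P v"
      have d: "d \<in> carrier N" using n Pv by (simp add: d_def)
      have "Q d = \<zero>\<^bsub>N\<^esub>"
        using lmod_hom_minus[OF N N Q n Pv] v(2) lmod_hom_closed[OF Q Pv] by (simp add: d_def a_minus_def N.r_neg)
      then have "P (g (r d)) = d"
        using N.minus_eq_zeroD[OF d lmod_hom_closed[OF Pgr d]] by (simp add: Q_def)
      moreover have "P v \<oplus>\<^bsub>N\<^esub> d = n"
        using n Pv by (simp add: d_def a_minus_def N.a_lcomm N.r_neg)
      ultimately have "n = P v \<oplus>\<^bsub>N\<^esub> P (g (r d))" by simp
      then show "n \<in> P ` (W <+>\<^bsub>N\<^esub> g ` carrier Y)"
        using image[OF v(1) rc[OF d]] by simp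
    qed
  qed
qed

definition brick_generated ::
    "('r, 'e) ring_scheme \<Rightarrow> ('r, 'x) module set \<Rightarrow> ('r, 'n) module \<Rightarrow> 'n set \<Rightarrow> bool" where
  "brick_generated R \<X> N V \<longleftrightarrow> (\<forall>v\<in>V. \<exists>W\<in>brick_sums R \<X> N. v \<in> W \<and> W \<subseteq> V)"

lemma brick_generated_saturated:
  assumes \<X>: "\<And>X. X \<in> \<X> \<Longrightarrow> left_module R X" and N: "left_module R N" and split: "brick_homs_split R \<X> N"
    and V: "brick_generated R \<X> N V" and X: "X \<in> \<X>" and h: "h \<in> lmod_hom R X N"
    and x: "x \<in> carrier X" "x \<noteq> \<zero>\<^bsub>X\<^esub>" "h x \<in> V"
  shows "h ` carrier X \<subseteq> V"
proof -
  obtain W where W: "W \<in> brick_sums R \<X> N" "h x \<in> W" "W \<subseteq> V"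
    using V x(3) unfolding brick_generated_def by blast
  have "(\<lambda>n. n) \<in> lmod_hom R N N"
    by (rule lmod_homI) auto
  from brick_sums_saturated_aux[OF \<X> N split W(1) this X h x(1,2)] W(2) have "h ` carrier X \<subseteq> W"
    by simp
  then show ?thesis
    using W(3) by blast
qed

lemma brick_generated_zero: "brick_generated R \<X> N {\<zero>\<^bsub>N\<^esub>}"
  using brick_sums.zero by (force simp: brick_generated_def)

lemma brick_generated_set_add:
  assumes N: "left_module R N" and "brick_generated R \<X> N V" "brick_generated R \<X> N V'"
  shows "brick_generated R \<X> N (V <+>\<^bsub>N\<^esub> V')"
  unfolding brick_generated_def
proof
  fix c assume "c \<in> V <+>\<^bsub>N\<^esub> V'"
  then obtain a b where ab: "a \<in> V" "b \<in> V'" "c = a \<oplus>\<^bsub>N\<^esub> b"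
    by (rule set_add_memE)
  obtain A where A: "A \<in> brick_sums R \<X> N" "a \<in> A" "A \<subseteq> V"
    using ab(1) assms(2) unfolding brick_generated_def by blast
  obtain B where B: "B \<in> brick_sums R \<X> N" "b \<in> B" "B \<subseteq> V'"
    using ab(2) assms(3) unfolding brick_generated_def by blast
  have "A <+>\<^bsub>N\<^esub> B \<subseteq> V <+>\<^bsub>N\<^esub> V'"
    using A(3) B(3) by (auto elim!: set_add_memE intro: set_add_memI)
  then show "\<exists>W\<in>brick_sums R \<X> N. c \<in> W \<and> W \<subseteq> V <+>\<^bsub>N\<^esub> V'"
    using brick_sums_set_add[OF N A(1) B(1)] set_add_memI[OF A(2) B(2)] ab(3) by blast
qed

lemma brick_generated_lmod_sum_image:
  assumes \<X>: "\<And>X. X \<in> \<X> \<Longrightarrow> left_module R X" and N: "left_module R N"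
    and G: "\<And>j. j \<in> J \<Longrightarrow> G j \<in> \<X>" and g: "g \<in> lmod_hom R (lmod_sum J G) N"
  shows "brick_generated R \<X> N (g ` carrier (lmod_sum J G))"
proof -
  let ?S = "lmod_sum J G"
  interpret N: abelian_group N using N by (rule left_module_abelian_group)
  have modG: "left_module R (G j)" if "j \<in> J" for j
    using \<X> G that by blast
  have S: "left_module R ?S"
    using left_module_lmod_sum[OF _ modG] N by (simp add: left_module_def)
  interpret S: abelian_group ?S using S by (rule left_module_abelian_group)
  have "\<exists>W\<in>brick_sums R \<X> N. g x \<in> W \<and> W \<subseteq> g ` carrier ?S" if "x \<in> carrier ?S" for x
    using modG that
  proof (rule lmod_sum_induct)
    show "\<exists>W\<in>brick_sums R \<X> N. g \<zero>\<^bsub>?S\<^esub> \<in> W \<and> W \<subseteq> g ` carrier ?S"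
      using lmod_hom_zero[OF S N g] by (intro bexI[OF _ brick_sums.zero]) (auto intro: rev_image_eqI)
  next
    fix j a assume j: "j \<in> J" "a \<in> carrier (G j)"
    let ?e = "\<lambda>a. sum_ext J {j} G (\<lambda>_. a)"
    have e: "?e \<in> lmod_hom R (G j) ?S"
      using sum_ext_singleton_hom[OF modG j(1)] .
    have ge: "(\<lambda>a. g (?e a)) \<in> lmod_hom R (G j) N"
      using lmod_hom_comp[OF e g] .
    have "{\<zero>\<^bsub>N\<^esub>} <+>\<^bsub>N\<^esub> (\<lambda>a. g (?e a)) ` carrier (G j) = (\<lambda>a. g (?e a)) ` carrier (G j)"
      using lmod_hom_closed[OF ge] by (force simp: set_add_def')
    then have "(\<lambda>a. g (?e a)) ` carrier (G j) \<in> brick_sums R \<X> N"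
      using brick_sums.add[OF brick_sums.zero G[OF j(1)] ge] by simp
    then show "\<exists>W\<in>brick_sums R \<X> N. g (?e a) \<in> W \<and> W \<subseteq> g ` carrier ?S"
      using j(2) lmod_hom_closed[OF e] by (intro bexI) auto
  next
    fix x y assume xy: "x \<in> carrier ?S" "y \<in> carrier ?S"
      and "\<exists>W\<in>brick_sums R \<X> N. g x \<in> W \<and> W \<subseteq> g ` carrier ?S"
      and "\<exists>W\<in>brick_sums R \<X> N. g y \<in> W \<and> W \<subseteq> g ` carrier ?S"
    then obtain A B where A: "A \<in> brick_sums R \<X> N" "g x \<in> A" "A \<subseteq> g ` carrier ?S"
      and B: "B \<in> brick_sums R \<X> N" "g y \<in> B" "B \<subseteq> g ` carrier ?S"
      by blast
    have "A <+>\<^bsub>N\<^esub> B \<subseteq> g ` carrier ?S"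
    proof
      fix c assume "c \<in> A <+>\<^bsub>N\<^esub> B"
      then obtain a b where ab: "a \<in> A" "b \<in> B" "c = a \<oplus>\<^bsub>N\<^esub> b"
        by (rule set_add_memE)
      then obtain s t where "s \<in> carrier ?S" "t \<in> carrier ?S" "a = g s" "b = g t"
        using A(3) B(3) by blast
      then show "c \<in> g ` carrier ?S"
        using ab(3) lmod_hom_add[OF g, of s t] by (intro rev_image_eqI[of "s \<oplus>\<^bsub>?S\<^esub> t"]) auto
    qed
    then show "\<exists>W\<in>brick_sums R \<X> N. g (x \<oplus>\<^bsub>?S\<^esub> y) \<in> W \<and> W \<subseteq> g ` carrier ?S"
      using brick_sums_set_add[OF N A(1) B(1)] set_add_memI[OF A(2) B(2)] lmod_hom_add[OF g xy] by metis
  qed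
  then show ?thesis
    by (auto simp: brick_generated_def)
qed

subsection \<open>Kernel and cokernel\<close>

definition submod :: "('r, 'e) ring_scheme \<Rightarrow> ('r, 'n) module \<Rightarrow> 'n set \<Rightarrow> bool" where
  "submod R N W \<longleftrightarrow> W \<subseteq> carrier N \<and> \<zero>\<^bsub>N\<^esub> \<in> W \<and>
     (\<forall>x\<in>W. \<forall>y\<in>W. x \<oplus>\<^bsub>N\<^esub> y \<in> W) \<and> (\<forall>x\<in>W. \<ominus>\<^bsub>N\<^esub> x \<in> W) \<and>
     (\<forall>r\<in>carrier R. \<forall>x\<in>W. r \<odot>\<^bsub>N\<^esub> x \<in> W)"

lemma submod_image:
  assumes M: "left_module R M" and N: "left_module R N" and f: "f \<in> lmod_hom R M N"
  shows "submod R N (f ` carrier M)"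
proof -
  interpret left_module R M by fact
  have "\<zero>\<^bsub>N\<^esub> \<in> f ` carrier M"
    using lmod_hom_zero[OF M N f] by (intro rev_image_eqI[of "\<zero>\<^bsub>M\<^esub>"]) auto
  moreover have "f x \<oplus>\<^bsub>N\<^esub> f y \<in> f ` carrier M" if "x \<in> carrier M" "y \<in> carrier M" for x y
    using lmod_hom_add[OF f that] that by (intro rev_image_eqI[of "x \<oplus>\<^bsub>M\<^esub> y"]) auto
  moreover have "\<ominus>\<^bsub>N\<^esub> f x \<in> f ` carrier M" if "x \<in> carrier M" for x
    using lmod_hom_a_inv[OF M N f that] that by (intro rev_image_eqI[of "\<ominus>\<^bsub>M\<^esub> x"]) auto
  moreover have "r \<odot>\<^bsub>N\<^esub> f x \<in> f ` carrier M" if "r \<in> carrier R" "x \<in> carrier M" for r x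
    using lmod_hom_smult[OF f that] that by (intro rev_image_eqI[of "r \<odot>\<^bsub>M\<^esub> x"]) auto
  ultimately show ?thesis
    using lmod_hom_closed[OF f] by (auto simp: submod_def)
qed

lemma submod_zero:
  assumes "left_module R N"
  shows "submod R N {\<zero>\<^bsub>N\<^esub>}"
proof -
  interpret left_module R N by fact
  have "\<ominus>\<^bsub>N\<^esub> \<zero>\<^bsub>N\<^esub> = \<zero>\<^bsub>N\<^esub>"
    by (rule M.minus_equality) auto
  then show ?thesis
    using left_module_smult_zero[OF assms] by (auto simp: submod_def)
qed

lemma exists_brick_sum_complement:
  fixes F :: "'i \<Rightarrow> ('r, 'x) module" and N :: "('r, 'n) module"
  assumes \<X>: "\<And>X. X \<in> \<X> \<Longrightarrow> left_module R X" and N: "left_module R N" and split: "brick_homs_split R \<X> N"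
    and F: "\<And>i. i \<in> I \<Longrightarrow> F i \<in> \<X>" and h: "h \<in> lmod_hom R (lmod_sum I F) N"
    and W: "submod R N W" "brick_generated R \<X> N W"
  obtains L where "L \<subseteq> I"
    and "\<And>x. x \<in> carrier (lmod_sum L F) \<Longrightarrow> h (sum_ext I L F x) \<in> W \<Longrightarrow> x = \<zero>\<^bsub>lmod_sum L F\<^esub>"
    and "\<And>x. x \<in> carrier (lmod_sum I F) \<Longrightarrow>
           \<exists>y\<in>carrier (lmod_sum L F). \<exists>w\<in>W. h x = h (sum_ext I L F y) \<oplus>\<^bsub>N\<^esub> w"
proof -
  let ?S = "lmod_sum I F"
  let ?supp = "\<lambda>x. {i \<in> I. x i \<noteq> \<zero>\<^bsub>F i\<^esub>}"
  interpret N: abelian_group N using N by (rule left_module_abelian_group)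
  have modF: "left_module R (F i)" if "i \<in> I" for i
    using \<X> F that by blast
  have S: "left_module R ?S"
    using left_module_lmod_sum[OF _ modF] N by (simp add: left_module_def)
  interpret S: abelian_group ?S using S by (rule left_module_abelian_group)
  define \<A> where "\<A> = {L. L \<subseteq> I \<and> (\<forall>x\<in>carrier ?S. ?supp x \<subseteq> L \<longrightarrow> h x \<in> W \<longrightarrow> x = \<zero>\<^bsub>?S\<^esub>)}"
  have zero: "x = \<zero>\<^bsub>?S\<^esub>" if "x \<in> carrier ?S" "?supp x = {}" for x
    using that lmod_sum_memD(1)[OF that(1)] by (auto simp: lmod_sum_sel intro!: extensionalityI[of _ I])
  have "\<exists>L\<in>\<A>. \<forall>L'\<in>\<A>. L \<subseteq> L' \<longrightarrow> L' = L"
  proof (rule subset_Zorn_nonempty)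
    have "{} \<in> \<A>" using zero by (auto simp: \<A>_def)
    then show "\<A> \<noteq> {}" by blast
  next
    fix \<C> assume ne: "\<C> \<noteq> {}" and ch: "subset.chain \<A> \<C>"
    have sub: "\<C> \<subseteq> \<A>" using ch by (auto simp: subset_chain_def)
    have "x = \<zero>\<^bsub>?S\<^esub>" if x: "x \<in> carrier ?S" "?supp x \<subseteq> \<Union>\<C>" "h x \<in> W" for x
    proof -
      obtain L where "L \<in> \<C>" "?supp x \<subseteq> L"
        using finite_subset_Union_chain[OF lmod_sum_memD(3)[OF x(1)] x(2) ne ch] .
      then show ?thesis using sub x by (auto simp: \<A>_def)
    qed
    moreover have "\<Union>\<C> \<subseteq> I"
      using sub by (auto simp: \<A>_def)
    ultimately show "\<Union>\<C> \<in> \<A>"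
      by (simp add: \<A>_def)
  qed
  then obtain L where L: "L \<in> \<A>" and max: "\<And>L'. L' \<in> \<A> \<Longrightarrow> L \<subseteq> L' \<Longrightarrow> L' = L"
    by blast
  have LI: "L \<subseteq> I" and indep: "\<And>x. x \<in> carrier ?S \<Longrightarrow> ?supp x \<subseteq> L \<Longrightarrow> h x \<in> W \<Longrightarrow> x = \<zero>\<^bsub>?S\<^esub>"
    using L by (auto simp: \<A>_def)
  have modL: "left_module R (lmod_sum L F)"
    using left_module_lmod_sum[of R L F] modF LI N by (auto simp: left_module_def)
  interpret SL: abelian_group "lmod_sum L F" using modL by (rule left_module_abelian_group)
  have e: "sum_ext I L F \<in> lmod_hom R (lmod_sum L F) ?S"
    using sum_ext_hom[OF modF LI] .
  have he: "(\<lambda>x. h (sum_ext I L F x)) \<in> lmod_hom R (lmod_sum L F) N"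
    using lmod_hom_comp[OF e h] .
  define U where "U = (\<lambda>x. h (sum_ext I L F x)) ` carrier (lmod_sum L F)"
  define V where "V = U <+>\<^bsub>N\<^esub> W"
  have U: "submod R N U"
    unfolding U_def using submod_image[OF modL N he] .
  have gen: "brick_generated R \<X> N V"
    unfolding V_def U_def using F LI
    by (intro brick_generated_set_add[OF N] W brick_generated_lmod_sum_image[OF \<X> N _ he]) auto
  have UV: "u \<in> V" if "u \<in> U" for u
    using set_add_memI[OF that, of "\<zero>\<^bsub>N\<^esub>" W N] W(1) U that by (auto simp: V_def submod_def subset_eq)
  have restr: "restrict x L \<in> carrier (lmod_sum L F)" if "x \<in> carrier ?S" for x
    using lmod_hom_closed[OF lmod_sum_restrict_hom[OF LI] that] .
  have ext_restr: "sum_ext I L F (restrict x L) = sum_ext I L F x" for x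
    by (auto simp: sum_ext_def)
  have ei: "(\<lambda>a. sum_ext I {i} F (\<lambda>_. a)) \<in> lmod_hom R (F i) ?S" if "i \<in> I" for i
    using sum_ext_singleton_hom[OF modF that] .
  have single: "h (sum_ext I {i} F (\<lambda>_. a)) \<in> V" if i: "i \<in> I" and a: "a \<in> carrier (F i)" for i a
  proof (cases "i \<in> L")
    case True
    have "sum_ext I {i} F (\<lambda>_. a) \<in> carrier ?S"
      using lmod_hom_closed[OF ei[OF i] a] .
    moreover have "sum_ext I L F (sum_ext I {i} F (\<lambda>_. a)) = sum_ext I {i} F (\<lambda>_. a)"
      using True LI by (auto simp: sum_ext_def fun_eq_iff)
    ultimately have "h (sum_ext I {i} F (\<lambda>_. a)) \<in> U"
      unfolding U_def using restr by (intro rev_image_eqI[of "restrict (sum_ext I {i} F (\<lambda>_. a)) L"])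
        (auto simp: ext_restr)
    then show ?thesis by (rule UV)
  next
    case False
    let ?e = "\<lambda>a. sum_ext I {i} F (\<lambda>_. a)"
    have "insert i L \<notin> \<A>"
      using max[of "insert i L"] False by blast
    then obtain x where x: "x \<in> carrier ?S" "?supp x \<subseteq> insert i L" "h x \<in> W" "x \<noteq> \<zero>\<^bsub>?S\<^esub>"
      using i LI unfolding \<A>_def by blast
    have xi: "x i \<in> carrier (F i)" "x i \<noteq> \<zero>\<^bsub>F i\<^esub>"
      using lmod_sum_memD(2)[OF x(1) i] indep[OF x(1)] x by auto
    let ?y = "sum_ext I L F (restrict x L)"
    have y: "?y \<in> carrier ?S"
      using lmod_hom_closed[OF e restr[OF x(1)]] .
    have exi: "?e (x i) \<in> carrier ?S"
      using lmod_hom_closed[OF ei[OF i] xi(1)] .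
    have "h x = h (?e (x i)) \<oplus>\<^bsub>N\<^esub> h ?y"
      using sum_ext_split[OF modF x(1,2) i False] lmod_hom_add[OF h exi y] by (simp add: ext_restr)
    then have "h (?e (x i)) = \<ominus>\<^bsub>N\<^esub> h ?y \<oplus>\<^bsub>N\<^esub> h x"
      using lmod_hom_closed[OF h] y exi by (simp add: N.a_lcomm[of "\<ominus>\<^bsub>N\<^esub> h ?y"] N.l_neg)
    moreover have "h ?y \<in> U"
      unfolding U_def using restr[OF x(1)] by blast
    then have "\<ominus>\<^bsub>N\<^esub> h ?y \<in> U"
      using U by (simp add: submod_def)
    ultimately have "h (?e (x i)) \<in> V"
      unfolding V_def using set_add_memI x(3) by metis
    from brick_generated_saturated[OF \<X> N split gen F[OF i] lmod_hom_comp[OF ei[OF i] h] xi this]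
    show ?thesis using a by blast
  qed
  have span: "h x \<in> V" if "x \<in> carrier ?S" for x
    using modF that
  proof (rule lmod_sum_induct)
    show "h \<zero>\<^bsub>?S\<^esub> \<in> V"
      using lmod_hom_zero[OF S N h] UV U by (simp add: submod_def)
  next
    fix x y assume xy: "x \<in> carrier ?S" "y \<in> carrier ?S" "h x \<in> V" "h y \<in> V"
    then obtain u w u' w' where uw: "u \<in> U" "w \<in> W" "u' \<in> U" "w' \<in> W"
      and eq: "h x = u \<oplus>\<^bsub>N\<^esub> w" "h y = u' \<oplus>\<^bsub>N\<^esub> w'"
      unfolding V_def by (metis set_add_memE)
    have "h (x \<oplus>\<^bsub>?S\<^esub> y) = (u \<oplus>\<^bsub>N\<^esub> u') \<oplus>\<^bsub>N\<^esub> (w \<oplus>\<^bsub>N\<^esub> w')"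
      using uw U W(1) unfolding lmod_hom_add[OF h xy(1,2)] eq
      by (simp add: submod_def subset_eq N.a_ac)
    then show "h (x \<oplus>\<^bsub>?S\<^esub> y) \<in> V"
      unfolding V_def using uw U W(1) by (simp add: submod_def set_add_memI)
  qed (auto intro: single)
  show thesis
  proof (rule that[OF LI])
    fix x assume x: "x \<in> carrier (lmod_sum L F)" "h (sum_ext I L F x) \<in> W"
    have "?supp (sum_ext I L F x) \<subseteq> L"
      by (auto simp: sum_ext_def)
    then have "sum_ext I L F x = \<zero>\<^bsub>?S\<^esub>"
      using indep lmod_hom_closed[OF e x(1)] x(2) by blast
    then have "x i = \<zero>\<^bsub>F i\<^esub>" if "i \<in> L" for i
      using that LI by (auto simp: sum_ext_def lmod_sum_sel dest!: fun_cong[of _ _ i])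
    then show "x = \<zero>\<^bsub>lmod_sum L F\<^esub>"
      using lmod_sum_memD(1)[OF x(1)] by (auto simp: lmod_sum_sel intro!: extensionalityI[of _ L])
  next
    fix x assume "x \<in> carrier ?S"
    from span[OF this] show "\<exists>y\<in>carrier (lmod_sum L F). \<exists>w\<in>W. h x = h (sum_ext I L F y) \<oplus>\<^bsub>N\<^esub> w"
      unfolding V_def U_def by (auto elim!: set_add_memE)
  qed
qed

lemma left_module_lmod_kernel:
  assumes M: "left_module R M" and N: "left_module R N" and f: "f \<in> lmod_hom R M N"
  shows "left_module R (lmod_kernel M N f)"
proof -
  interpret left_module R M by fact
  interpret N: abelian_group N using N by (rule left_module_abelian_group)
  have sel: "carrier (lmod_kernel M N f) = {x \<in> carrier M. f x = \<zero>\<^bsub>N\<^esub>}"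
    "\<zero>\<^bsub>lmod_kernel M N f\<^esub> = \<zero>\<^bsub>M\<^esub>" "add (lmod_kernel M N f) = add M" "smult (lmod_kernel M N f) = smult M"
    by (auto simp: lmod_kernel_def a_kernel_def')
  have "abelian_group (lmod_kernel M N f)"
  proof (rule abelian_groupI)
    fix x assume x: "x \<in> carrier (lmod_kernel M N f)"
    then have "\<ominus>\<^bsub>M\<^esub> x \<in> carrier (lmod_kernel M N f)"
      using lmod_hom_a_inv[OF M N f, of x] by (simp add: sel N.minus_equality)
    then show "\<exists>y\<in>carrier (lmod_kernel M N f). y \<oplus>\<^bsub>lmod_kernel M N f\<^esub> x = \<zero>\<^bsub>lmod_kernel M N f\<^esub>"
      using x by (auto simp: sel M.l_neg)
  qed (auto simp: sel lmod_hom_add[OF f] lmod_hom_zero[OF M N f] M.a_ac)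
  moreover have "left_module_axioms R (lmod_kernel M N f)"
    by (rule left_module_axioms.intro)
      (auto simp: sel lmod_hom_smult[OF f] left_module_smult_zero[OF N] smult_l_distr smult_r_distr smult_assoc1)
  ultimately show ?thesis
    using ring_axioms by (simp add: left_module_def)
qed

lemma lmod_quotient_proj_hom:
  assumes N: "left_module R N" and W: "submod R N W"
  shows "(\<lambda>x. W +>\<^bsub>N\<^esub> x) \<in> lmod_hom R N (lmod_quotient N W)"
    and "(\<lambda>x. W +>\<^bsub>N\<^esub> x) ` carrier N = carrier (lmod_quotient N W)"
    and "x \<in> carrier N \<Longrightarrow> W +>\<^bsub>N\<^esub> x = W \<longleftrightarrow> x \<in> W"
proof -
  interpret left_module R N by fact
  have "subgroup W (add_monoid N)"
    using W by (unfold_locales) (auto simp: submod_def a_inv_def)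
  then interpret W: abelian_subgroup W N
    by (intro abelian_subgroupI3 additive_subgroup.intro M.abelian_group_axioms)
  have sel: "carrier (lmod_quotient N W) = a_rcosets\<^bsub>N\<^esub> W" "add (lmod_quotient N W) = set_add N"
    "smult (lmod_quotient N W) r C = (\<Union>x\<in>C. W +>\<^bsub>N\<^esub> (r \<odot>\<^bsub>N\<^esub> x))" for r C
    by (auto simp: lmod_quotient_def)
  have WN: "W \<subseteq> carrier N" by (rule W.a_subset)
  have coset_eq: "W +>\<^bsub>N\<^esub> x = W +>\<^bsub>N\<^esub> y" if "x \<in> W +>\<^bsub>N\<^esub> y" "y \<in> carrier N" for x y
    using W.a_repr_independence'[OF that] by simp
  show "(\<lambda>x. W +>\<^bsub>N\<^esub> x) \<in> lmod_hom R N (lmod_quotient N W)"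
  proof (rule lmod_homI)
    fix r x assume rx: "r \<in> carrier R" "x \<in> carrier N"
    have "W +>\<^bsub>N\<^esub> (r \<odot>\<^bsub>N\<^esub> y) = W +>\<^bsub>N\<^esub> (r \<odot>\<^bsub>N\<^esub> x)" if "y \<in> W +>\<^bsub>N\<^esub> x" for y
    proof (rule coset_eq)
      obtain w where w: "w \<in> W" "y = w \<oplus>\<^bsub>N\<^esub> x"
        using \<open>y \<in> W +>\<^bsub>N\<^esub> x\<close> by (auto simp: a_r_coset_def')
      then have "r \<odot>\<^bsub>N\<^esub> y = r \<odot>\<^bsub>N\<^esub> w \<oplus>\<^bsub>N\<^esub> r \<odot>\<^bsub>N\<^esub> x"
        using rx WN by (auto simp: smult_r_distr)
      moreover have "r \<odot>\<^bsub>N\<^esub> w \<in> W"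
        using W w(1) rx(1) by (simp add: submod_def)
      ultimately show "r \<odot>\<^bsub>N\<^esub> y \<in> W +>\<^bsub>N\<^esub> (r \<odot>\<^bsub>N\<^esub> x)"
        by (auto simp: a_r_coset_def')
    qed (use rx in simp)
    moreover have "x \<in> W +>\<^bsub>N\<^esub> x"
      using W.a_rcos_self rx(2) by simp
    ultimately show "W +>\<^bsub>N\<^esub> (r \<odot>\<^bsub>N\<^esub> x) = r \<odot>\<^bsub>lmod_quotient N W\<^esub> (W +>\<^bsub>N\<^esub> x)"
      unfolding sel by blast
  qed (auto simp: sel W.a_rcos_sum intro: M.a_rcosetsI[OF WN])
  show "(\<lambda>x. W +>\<^bsub>N\<^esub> x) ` carrier N = carrier (lmod_quotient N W)"
    by (auto simp: sel A_RCOSETS_def')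
  show "W +>\<^bsub>N\<^esub> x = W \<longleftrightarrow> x \<in> W" if "x \<in> carrier N"
    using W.a_rcos_self[OF that] W.a_rcos_const by auto
qed

lemma left_module_lmod_quotient:
  assumes N: "left_module R N" and W: "submod R N W"
  shows "left_module R (lmod_quotient N W)"
proof (rule left_module_surj_image[OF N lmod_quotient_proj_hom(1,2)[OF assms]])
  interpret abelian_group N using N by (rule left_module_abelian_group)
  show "W +>\<^bsub>N\<^esub> \<zero>\<^bsub>N\<^esub> = \<zero>\<^bsub>lmod_quotient N W\<^esub>"
    using W lmod_quotient_proj_hom(3)[OF assms zero_closed] by (simp add: submod_def lmod_quotient_def)
qed

lemma semisimple_decomposition:
  fixes M :: "('r, 'm) module"
  assumes "semisimple R \<X> M"
  shows "\<exists>(I :: 'm set) F p q. (\<forall>i\<in>I. F i \<in> \<X>) \<and>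
    p \<in> lmod_hom R M (lmod_sum I F) \<and> q \<in> lmod_hom R (lmod_sum I F) M \<and>
    (\<forall>x\<in>carrier M. q (p x) = x) \<and> (\<forall>x\<in>carrier (lmod_sum I F). p (q x) = x)"
proof -
  have M: "left_module R M"
    using assms by (simp add: semisimple_def)
  obtain I :: "'m set" and F p where F: "\<forall>i\<in>I. F i \<in> \<X>"
    and p: "p \<in> lmod_hom R M (lmod_sum I F)" "bij_betw p (carrier M) (carrier (lmod_sum I F))"
    using assms(1) unfolding semisimple_def lmod_iso_def by blast
  have "\<forall>x\<in>carrier M. inv_into (carrier M) p (p x) = x"
    "\<forall>x\<in>carrier (lmod_sum I F). p (inv_into (carrier M) p x) = x"
    using p(2) by (auto simp: bij_betw_def f_inv_into_f)
  then show ?thesis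
    using F p(1) lmod_hom_inv_into[OF M p] by blast
qed

lemma semisimple_lmod_kernel:
  fixes M :: "('r, 'm) module" and N :: "('r, 'n) module"
  assumes \<X>: "semibrick R \<X>" and ssM: "semisimple R \<X> M" and ssN: "semisimple R \<X> N"
    and f: "f \<in> lmod_hom R M N"
  shows "semisimple R \<X> (lmod_kernel M N f)"
proof -
  let ?K = "lmod_kernel M N f"
  have M: "left_module R M" and N: "left_module R N"
    using ssM ssN by (simp_all add: semisimple_def)
  interpret M: abelian_group M using M by (rule left_module_abelian_group)
  interpret N: abelian_group N using N by (rule left_module_abelian_group)
  obtain I F p q where "\<forall>i\<in>(I :: 'm set). F i \<in> \<X>"
    and p: "p \<in> lmod_hom R M (lmod_sum I F)" and q: "q \<in> lmod_hom R (lmod_sum I F) M"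
    and "\<forall>x\<in>carrier M. q (p x) = x"
    and "\<forall>x\<in>carrier (lmod_sum I F). p (q x) = x"
    using semisimple_decomposition[OF ssM] by blast
  note F = bspec[OF this(1)] and qp = bspec[OF this(4)] and pq = bspec[OF this(5)]
  obtain J G p' q' where "\<forall>j\<in>(J :: 'n set). G j \<in> \<X>"
    and p': "p' \<in> lmod_hom R N (lmod_sum J G)" and q': "q' \<in> lmod_hom R (lmod_sum J G) N"
    and "\<forall>x\<in>carrier N. q' (p' x) = x"
    using semisimple_decomposition[OF ssN] by blast
  note G = bspec[OF this(1)] and qp' = bspec[OF this(4)]
  have split: "brick_homs_split R \<X> N"
    using brick_homs_split_if_embeds[OF \<X> N G p' inj_on_inverseI] qp' by blast
  have modF: "left_module R (F i)" if "i \<in> I" for i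
    using semibrick_left_module[OF \<X> F[OF that]] .
  let ?S = "lmod_sum I F"
  have ring: "ring R" using N by (simp add: left_module_def)
  have S: "left_module R ?S"
    using left_module_lmod_sum[OF ring modF] .
  interpret S: abelian_group ?S using S by (rule left_module_abelian_group)
  have fq: "(\<lambda>x. f (q x)) \<in> lmod_hom R ?S N"
    using lmod_hom_comp[OF q f] .
  obtain L where L: "L \<subseteq> I"
    and inj: "\<And>x. x \<in> carrier (lmod_sum L F) \<Longrightarrow> f (q (sum_ext I L F x)) \<in> {\<zero>\<^bsub>N\<^esub>} \<Longrightarrow> x = \<zero>\<^bsub>lmod_sum L F\<^esub>"
    and span: "\<And>x. x \<in> carrier ?S \<Longrightarrow>
      \<exists>y\<in>carrier (lmod_sum L F). \<exists>w\<in>{\<zero>\<^bsub>N\<^esub>}. f (q x) = f (q (sum_ext I L F y)) \<oplus>\<^bsub>N\<^esub> w"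
    using exists_brick_sum_complement[OF semibrick_left_module[OF \<X>] N split F fq submod_zero[OF N]
        brick_generated_zero] by blast
  let ?C = "lmod_sum (I - L) F"
  have C: "left_module R ?C"
    using left_module_lmod_sum[OF ring, of "I - L" F] modF by auto
  have K: "left_module R ?K"
    using left_module_lmod_kernel[OF M N f] .
  have selK: "carrier ?K = {x \<in> carrier M. f x = \<zero>\<^bsub>N\<^esub>}" "add ?K = add M" "smult ?K = smult M" "\<zero>\<^bsub>?K\<^esub> = \<zero>\<^bsub>M\<^esub>"
    by (auto simp: lmod_kernel_def a_kernel_def')
  have incl: "(\<lambda>x. x) \<in> lmod_hom R ?K M"
    by (rule lmod_homI) (auto simp: selK)
  have res: "(\<lambda>x. restrict x (I - L)) \<in> lmod_hom R ?S ?C"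
    by (rule lmod_sum_restrict_hom) auto
  have hom: "(\<lambda>x. restrict (p x) (I - L)) \<in> lmod_hom R ?K ?C"
    using lmod_hom_comp[OF lmod_hom_comp[OF incl p] res] .
  have eL: "sum_ext I L F \<in> lmod_hom R (lmod_sum L F) ?S"
    using sum_ext_hom[OF modF L] .
  have eC: "sum_ext I (I - L) F \<in> lmod_hom R ?C ?S"
    by (rule sum_ext_hom[OF modF Diff_subset])
  have "bij_betw (\<lambda>x. restrict (p x) (I - L)) (carrier ?K) (carrier ?C)"
    unfolding bij_betw_def
  proof
    show "inj_on (\<lambda>x. restrict (p x) (I - L)) (carrier ?K)"
    proof (rule lmod_hom_inj_onI[OF K C hom])
      fix x assume x: "x \<in> carrier ?K" "restrict (p x) (I - L) = \<zero>\<^bsub>?C\<^esub>"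
      have xM: "x \<in> carrier M" "f x = \<zero>\<^bsub>N\<^esub>" using x(1) by (auto simp: selK)
      have px: "p x \<in> carrier ?S" using lmod_hom_closed[OF p xM(1)] .
      have off: "p x i = \<zero>\<^bsub>F i\<^esub>" if "i \<in> I" "i \<notin> L" for i
        using fun_cong[OF x(2), of i] that by (simp add: lmod_sum_sel)
      have ext: "sum_ext I L F (restrict (p x) L) = p x"
        using lmod_sum_memD(1)[OF px] off
        by (intro extensionalityI[of _ I]) (auto simp: sum_ext_def)
      have "restrict (p x) L = \<zero>\<^bsub>lmod_sum L F\<^esub>"
        using lmod_hom_closed[OF lmod_sum_restrict_hom[OF L] px] xM by (intro inj) (auto simp: ext qp)
      then have "p x i = \<zero>\<^bsub>F i\<^esub>" if "i \<in> L" for i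
        using that by (auto simp: lmod_sum_sel dest: fun_cong[of _ _ i])
      then have "p x = \<zero>\<^bsub>?S\<^esub>"
        using lmod_sum_memD(1)[OF px] off by (intro extensionalityI[of _ I]) (auto simp: lmod_sum_sel)
      then show "x = \<zero>\<^bsub>?K\<^esub>"
        using qp[OF xM(1)] lmod_hom_zero[OF S M q] by (simp add: selK)
    qed
    have "z \<in> (\<lambda>x. restrict (p x) (I - L)) ` carrier ?K" if z: "z \<in> carrier ?C" for z
    proof -
      let ?z = "sum_ext I (I - L) F z"
      have zS: "?z \<in> carrier ?S" using lmod_hom_closed[OF eC z] .
      obtain y where y: "y \<in> carrier (lmod_sum L F)" "f (q ?z) = f (q (sum_ext I L F y)) \<oplus>\<^bsub>N\<^esub> \<zero>\<^bsub>N\<^esub>"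
        using span[OF zS] by blast
      let ?y = "sum_ext I L F y"
      have yS: "?y \<in> carrier ?S" using lmod_hom_closed[OF eL y(1)] .
      let ?x = "?z \<ominus>\<^bsub>?S\<^esub> ?y"
      have xS: "?x \<in> carrier ?S" using zS yS by simp
      have "f (q ?x) = \<zero>\<^bsub>N\<^esub>"
        using lmod_hom_minus[OF S N fq zS yS] y(2) lmod_hom_closed[OF fq yS] by (simp add: a_minus_def N.r_neg)
      then have qx: "q ?x \<in> carrier ?K"
        using lmod_hom_closed[OF q xS] by (simp add: selK)
      have "restrict ?x (I - L) = restrict ?z (I - L) \<ominus>\<^bsub>?C\<^esub> restrict ?y (I - L)"
        using lmod_hom_minus[OF S C res zS yS] .
      moreover have "restrict ?z (I - L) = z"
        using lmod_sum_memD(1)[OF z] by (intro extensionalityI[of _ "I - L"]) (auto simp: sum_ext_def)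
      moreover have "restrict ?y (I - L) = \<zero>\<^bsub>?C\<^esub>"
        by (auto simp: sum_ext_def lmod_sum_sel)
      moreover interpret C: abelian_group ?C using C by (rule left_module_abelian_group)
      have "z \<ominus>\<^bsub>?C\<^esub> \<zero>\<^bsub>?C\<^esub> = z"
        using z C.minus_equality[of "\<zero>\<^bsub>?C\<^esub>" "\<zero>\<^bsub>?C\<^esub>"] by (simp add: a_minus_def)
      ultimately show ?thesis
        using qx pq[OF xS] by (intro rev_image_eqI[of "q ?x"]) auto
    qed
    then show "(\<lambda>x. restrict (p x) (I - L)) ` carrier ?K = carrier ?C"
      using lmod_hom_closed[OF hom] by blast
  qed
  with hom have "lmod_iso R ?K ?C"
    unfolding lmod_iso_def by blast
  then show ?thesis
    using F by (intro semisimpleI[OF \<X> K]) auto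
qed

lemma semisimple_lmod_cokernel:
  fixes M :: "('r, 'm) module" and N :: "('r, 'n) module"
  assumes \<X>: "semibrick R \<X>" and ssM: "semisimple R \<X> M" and ssN: "semisimple R \<X> N"
    and f: "f \<in> lmod_hom R M N"
  shows "semisimple R \<X> (lmod_cokernel M N f)"
proof -
  define W where "W = f ` carrier M"
  let ?Q = "lmod_quotient N W"
  have M: "left_module R M" and N: "left_module R N"
    using ssM ssN by (simp_all add: semisimple_def)
  interpret N: abelian_group N using N by (rule left_module_abelian_group)
  obtain I F p q where "\<forall>i\<in>(I :: 'm set). F i \<in> \<X>"
    and p: "p \<in> lmod_hom R M (lmod_sum I F)" and q: "q \<in> lmod_hom R (lmod_sum I F) M"
    and "\<forall>x\<in>carrier M. q (p x) = x"
    and "\<forall>x\<in>carrier (lmod_sum I F). p (q x) = x"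
    using semisimple_decomposition[OF ssM] by blast
  note F = bspec[OF this(1)] and qp = bspec[OF this(4)]
  obtain J G p' q' where "\<forall>j\<in>(J :: 'n set). G j \<in> \<X>"
    and p': "p' \<in> lmod_hom R N (lmod_sum J G)" and q': "q' \<in> lmod_hom R (lmod_sum J G) N"
    and "\<forall>x\<in>carrier N. q' (p' x) = x"
    using semisimple_decomposition[OF ssN] by blast
  note G = bspec[OF this(1)] and qp' = bspec[OF this(4)]
  have split: "brick_homs_split R \<X> N"
    using brick_homs_split_if_embeds[OF \<X> N G p' inj_on_inverseI] qp' by blast
  have W: "submod R N W"
    unfolding W_def using submod_image[OF M N f] .
  have "W = (\<lambda>x. f (q x)) ` carrier (lmod_sum I F)"
    unfolding W_def using qp lmod_hom_closed[OF p] lmod_hom_closed[OF q] by (force simp: image_iff)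
  then have gen: "brick_generated R \<X> N W"
    using brick_generated_lmod_sum_image[OF semibrick_left_module[OF \<X>] N F lmod_hom_comp[OF q f]] by simp
  obtain L where L: "L \<subseteq> J"
    and inj: "\<And>x. x \<in> carrier (lmod_sum L G) \<Longrightarrow> q' (sum_ext J L G x) \<in> W \<Longrightarrow> x = \<zero>\<^bsub>lmod_sum L G\<^esub>"
    and span: "\<And>x. x \<in> carrier (lmod_sum J G) \<Longrightarrow>
      \<exists>y\<in>carrier (lmod_sum L G). \<exists>w\<in>W. q' x = q' (sum_ext J L G y) \<oplus>\<^bsub>N\<^esub> w"
    using exists_brick_sum_complement[OF semibrick_left_module[OF \<X>] N split G q' W gen] by blast
  let ?C = "lmod_sum L G"
  have modG: "left_module R (G j)" if "j \<in> J" for j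
    using semibrick_left_module[OF \<X> G[OF that]] .
  have C: "left_module R ?C"
    using left_module_lmod_sum[of R L G] modG L N by (auto simp: left_module_def)
  have Q: "left_module R ?Q"
    using left_module_lmod_quotient[OF N W] .
  interpret Q: abelian_group ?Q using Q by (rule left_module_abelian_group)
  note proj = lmod_quotient_proj_hom[OF N W]
  have qe: "(\<lambda>z. q' (sum_ext J L G z)) \<in> lmod_hom R ?C N"
    using lmod_hom_comp[OF sum_ext_hom[OF modG L] q'] .
  have hom: "(\<lambda>z. W +>\<^bsub>N\<^esub> q' (sum_ext J L G z)) \<in> lmod_hom R ?C ?Q"
    using lmod_hom_comp[OF qe proj(1)] .
  have zeroQ: "\<zero>\<^bsub>?Q\<^esub> = W"
    by (simp add: lmod_quotient_def)
  have "bij_betw (\<lambda>z. W +>\<^bsub>N\<^esub> q' (sum_ext J L G z)) (carrier ?C) (carrier ?Q)"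
    unfolding bij_betw_def
  proof
    show "inj_on (\<lambda>z. W +>\<^bsub>N\<^esub> q' (sum_ext J L G z)) (carrier ?C)"
      by (rule lmod_hom_inj_onI[OF C Q hom]) (use inj proj(3) lmod_hom_closed[OF qe] zeroQ in auto)
    have "c \<in> (\<lambda>z. W +>\<^bsub>N\<^esub> q' (sum_ext J L G z)) ` carrier ?C" if "c \<in> carrier ?Q" for c
    proof -
      obtain n where n: "n \<in> carrier N" "c = W +>\<^bsub>N\<^esub> n"
        using imageE[OF \<open>c \<in> carrier ?Q\<close>[folded proj(2)]] .
      obtain y w where y: "y \<in> carrier ?C" and w: "w \<in> W" and eq: "n = q' (sum_ext J L G y) \<oplus>\<^bsub>N\<^esub> w"
        using span[OF lmod_hom_closed[OF p' n(1)]] qp'[OF n(1)] by metis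
      have wN: "w \<in> carrier N" using w W by (auto simp: submod_def)
      have "c = (W +>\<^bsub>N\<^esub> q' (sum_ext J L G y)) \<oplus>\<^bsub>?Q\<^esub> \<zero>\<^bsub>?Q\<^esub>"
        using lmod_hom_add[OF proj(1) lmod_hom_closed[OF qe y] wN] proj(3)[OF wN] w n(2) eq zeroQ by simp
      then show ?thesis
        using y lmod_hom_closed[OF hom y] by auto
    qed
    then show "(\<lambda>z. W +>\<^bsub>N\<^esub> q' (sum_ext J L G z)) ` carrier ?C = carrier ?Q"
      using lmod_hom_closed[OF hom] by blast
  qed
  with hom have "lmod_iso R ?C ?Q"
    unfolding lmod_iso_def by blast
  then have "lmod_iso R ?Q ?C"
    by (rule lmod_iso_sym[OF C])
  then have "semisimple R \<X> ?Q"
    using G L by (intro semisimpleI[OF \<X> Q]) auto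
  then show ?thesis
    by (simp add: lmod_cokernel_def W_def)
qed

theorem proposition3p6:
  fixes R :: "('r, 'e) ring_scheme"
    and \<X> :: "('r, 'x) module set"
    and M :: "('r, 'm) module"
    and N :: "('r, 'n) module"
    and f :: "'m \<Rightarrow> 'n"
  assumes "ring R"
    and "semibrick R \<X>"
    and "semisimple R \<X> M"
    and "semisimple R \<X> N"
    and "f \<in> lmod_hom R M N"
    and "\<not> zero_map M N f"
  shows "semisimple R \<X> (lmod_kernel M N f) \<and> semisimple R \<X> (lmod_cokernel M N f)"
  using semisimple_lmod_kernel[OF assms(2-5)] semisimple_lmod_cokernel[OF assms(2-5)] by simp

end
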